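(* Let $2\le d\le n$, and consider the set of discrete-time load balancing systems with $n$ servers operating under power-of-$d$ choices, parametrized by $\epsilon\in(0,\mu_\Sigma)$ as described in the context: the i.i.d. potential service vectors $\{\boldsymbol s(k)\}$, with mean $\boldsymbol\mu$, covariance matrix $\Sigma_s$ and $\mu_\Sigma=\sum_{i=1}^n\mu_i$, do not depend on $\epsilon$, and the arrival process has mean $\lambda^{(\epsilon)}=\mu_\Sigma-\epsilon$. Suppose that the number of arrivals and the potential service in each time slot are bounded. Let $\boldsymbol\mu\in\mathrm{Int}(\mathcal M^{(d)})$, where $\mathrm{Int}$ denotes interior in $\mathbb R^n$ and $$\mathcal M^{(d)}=\left\{\boldsymbol\mu\in\mathbb R_+^n:\ \frac{\sum_{i=1}^{j}\mu_{(i)}}{\mu_\Sigma}\ \ge\ \frac{\binom{j}{d}}{\binom{n}{d}}\quad\text{for all integers } j \text{ with } d\le j\le n-1\right\}.$$ For each $\epsilon$ let $\overline{\boldsymbol q}^{(\epsilon)}$ be a steady-state random vector such that $\{\boldsymbol q^{(\epsilon)}(k):k\in\mathbb Z_+\}$ converges in distribution to $\overline{\boldsymbol q}^{(\epsilon)}$ as $k\to\infty$. Let $\sigma_a^{(\epsilon)}$ be the standard deviation of $a^{(\epsilon)}(1)$ and assume $\sigma_a=\lim_{\epsilon\downarrow 0}\sigma_a^{(\epsilon)}$. Then, as $\epsilon\downarrow 0$, $$\epsilon\,\overline{\boldsymbol q}^{(\epsilon)}\Longrightarrow \Upsilon\,\boldsymbol 1,$$ where $\Longrightarrow$ denotes convergence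 in distribution and $\Upsilon$ is an exponential random variable with mean $\frac{1}{2n}\left(\sigma_a^2+\boldsymbol 1^{T}\Sigma_s\boldsymbol 1\right)$.
   Context: Notation: $\mathbb R_+$, $\mathbb Z_+$ are the nonnegative reals and integers; $\mu_{(i)}$ is the $i$-th smallest entry of $\boldsymbol\mu$; $\boldsymbol 1$ is the all-ones vector in $\mathbb R^n$. Model. Time is slotted, $k\in\mathbb Z_+$. There are $n$ servers, each with an infinite-buffer queue; $q_i(k)\in\mathbb Z_+$ is the number of jobs in queue $i$ (including any in service) at the beginning of slot $k$, and $\boldsymbol q(k)=(q_1(k),\dots,q_n(k))$. The total number of arrivals in slot $k$ is $a(k)\in\mathbb Z_+$, with $\{a(k)\}$ i.i.d. In each slot a dispatcher sends all arrivals of that slot to a single queue $i^*$, so $a_{i^*}(k)=a(k)$ and $a_i(k)=0$ for $i\ne i^*$. The potential service vectors $\boldsymbol s(k)\in\mathbb Z_+^n$ ($s_i(k)$ is the number of jobs that can be processed in queue $i$ in slot $k$ if there are enough jobs in line) are i.i.d. over $k$ (entries within a slot may be dependent), with mean $\boldsymbol\mu=\mathbb E[\boldsymbol s(1)]$ and covariance matrix $\Sigma_s$ of $\boldsymbol s(1)$, and are independent of the arrivals; $\boldsymbol s(k)$ is independent of the queue lengths up to slot $k$ and of the routing decision in slot $k$. Arrivals and routing occur before service in each slot, so $$q_i(k+1)=q_i(k)+a_i(k)-s_i(k)+u_i(k),\qquad u_i(k)=\max\{s_i(k)-q_i(k)-a_i(k),0\}.$$ Power-of-$d$ choices. In each slot,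 select $d$ distinct queues uniformly at random among the $n$ queues and route all arrivals of the slot to a shortest (with respect to $\boldsymbol q(k)$) of the selected queues, ties being broken at random. Heavy-traffic parametrization. The sequence of service vectors $\{\boldsymbol s(k)\}$ is fixed (it does not depend on $\epsilon$). For each $\epsilon\in(0,\mu_\Sigma)$, the system parametrized by $\epsilon$ has an i.i.d. arrival sequence $\{a^{(\epsilon)}(k)\}$ with mean $\lambda^{(\epsilon)}=\mathbb E[a^{(\epsilon)}(1)]=\mu_\Sigma-\epsilon$; its queue length process is denoted $\{\boldsymbol q^{(\epsilon)}(k)\}$. *)

theory Defs
  imports "HOL-Probability.Probability"
begin

definition iid_seq :: "'w measure \<Rightarrow> 'b measure \<Rightarrow> (nat \<Rightarrow> 'w \<Rightarrow> 'b) \<Rightarrow> bool" where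
  "iid_seq M N X \<longleftrightarrow>
     prob_space.indep_vars M (\<lambda>_. N) X UNIV \<and> (\<forall>k. distr M N (X k) = distr M N (X 0))"

text \<open>The library's \<open>indep_var\<close> requires both variables to take values in the same type.\<close>

definition independent ::
  "'w measure \<Rightarrow> 'b measure \<Rightarrow> ('w \<Rightarrow> 'b) \<Rightarrow> 'c measure \<Rightarrow> ('w \<Rightarrow> 'c) \<Rightarrow> bool" where
  "independent M N X L Y \<longleftrightarrow>
     X \<in> measurable M N \<and> Y \<in> measurable M L \<and>
     prob_space.indep_set M {X -` A \<inter> space M |A. A \<in> sets N} {Y -` B \<inter> space M |B. B \<in> sets L}"

text \<open>
  The library's \<open>weak_conv_m\<close> covers only sequences of distributions on the real line. The version
  below is for random elements of an arbitrary topological space, each possibly living on its own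
  probability space, along an arbitrary filter.
\<close>

definition converges_in_distribution ::
  "'i filter \<Rightarrow> ('i \<Rightarrow> 'w measure) \<Rightarrow> ('i \<Rightarrow> 'w \<Rightarrow> 'b::topological_space) \<Rightarrow>
   'v measure \<Rightarrow> ('v \<Rightarrow> 'b) \<Rightarrow> bool" where
  "converges_in_distribution F M X N Y \<longleftrightarrow>
     (\<forall>\<^sub>F i in F. X i \<in> borel_measurable (M i)) \<and> Y \<in> borel_measurable N \<and>
     (\<forall>f :: 'b \<Rightarrow> real. continuous_on UNIV f \<longrightarrow> bounded (range f) \<longrightarrow>
        ((\<lambda>i. \<integral>\<omega>. f (X i \<omega>) \<partial>M i) \<longlongrightarrow> (\<integral>\<omega>. f (Y \<omega>) \<partial>N)) F)"

text \<open>
  \<open>exponential_density\<close> is parametrized by the rate. The exponential distribution with mean zero is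
  the point mass at zero.
\<close>

definition exponential_with_mean :: "'v measure \<Rightarrow> ('v \<Rightarrow> real) \<Rightarrow> real \<Rightarrow> bool" where
  "exponential_with_mean N Y m \<longleftrightarrow>
     (if m = 0 then distr N borel Y = return borel 0
      else distributed N lborel Y (exponential_density (1 / m)))"

definition real_vec :: "nat ^ 'n \<Rightarrow> real ^ 'n" where
  "real_vec v = (\<chi> i. real (v $ i))"

definition mean_vec :: "'w measure \<Rightarrow> ('w \<Rightarrow> real ^ 'n) \<Rightarrow> real ^ 'n" where
  "mean_vec M X = (\<chi> i. \<integral>\<omega>. X \<omega> $ i \<partial>M)"

definition covariance_matrix :: "'w measure \<Rightarrow> ('w \<Rightarrow> real ^ 'n) \<Rightarrow> real ^ 'n ^ 'n" where
  "covariance_matrix M X =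
     (\<chi> i j. \<integral>\<omega>. (X \<omega> $ i - mean_vec M X $ i) * (X \<omega> $ j - mean_vec M X $ j) \<partial>M)"

text \<open>The \<open>i\<close>-th smallest entry of a vector, counted from \<open>i = 1\<close> and with multiplicity.\<close>

definition nth_smallest :: "real ^ 'n \<Rightarrow> nat \<Rightarrow> real" where
  "nth_smallest \<mu> i = sorted_list_of_multiset (image_mset (\<lambda>j. \<mu> $ j) (mset_set UNIV)) ! (i - 1)"

definition capacity_set :: "nat \<Rightarrow> (real ^ 'n) set" where
  "capacity_set d =
     {\<mu>. (\<forall>i. 0 \<le> \<mu> $ i) \<and>
         (\<forall>j. d \<le> j \<and> j \<le> CARD('n) - 1 \<longrightarrow>
            (\<Sum>i=1..j. nth_smallest \<mu> i) / (\<Sum>i\<in>UNIV. \<mu> $ i)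
              \<ge> real (j choose d) / real (CARD('n) choose d))}"

definition shortest :: "nat ^ 'n \<Rightarrow> 'n set \<Rightarrow> 'n set" where
  "shortest v D = {i \<in> D. \<forall>j\<in>D. v $ i \<le> v $ j}"

definition arrivals_at :: "nat \<Rightarrow> 'n \<Rightarrow> 'n \<Rightarrow> nat" where
  "arrivals_at x i\<^sub>0 i = (if i = i\<^sub>0 then x else 0)"

definition unused_service :: "nat ^ 'n \<Rightarrow> nat \<Rightarrow> nat ^ 'n \<Rightarrow> 'n \<Rightarrow> 'n \<Rightarrow> int" where
  "unused_service v x y i\<^sub>0 i = max (int (y $ i) - int (v $ i) - int (arrivals_at x i\<^sub>0 i)) 0"

text \<open>
  A system is given by its total arrivals \<open>a k\<close>, its potential services \<open>s k\<close>, the set \<open>sel k\<close> of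
  sampled queues, the queue \<open>dest k\<close> that receives all arrivals of slot \<open>k\<close>, and its queue lengths
  \<open>q k\<close> at the beginning of slot \<open>k\<close>. All these variables are discrete, so measurability and
  independence refer to \<open>count_space UNIV\<close>, and conditioning is elementary. \<open>history\<close> collects the
  queue lengths up to slot \<open>k\<close> and everything else that happened before slot \<open>k\<close>. The initial queue
  lengths \<open>q 0\<close> are arbitrary (possibly random).
\<close>

definition history ::
  "(nat \<Rightarrow> 'w \<Rightarrow> nat) \<Rightarrow> (nat \<Rightarrow> 'w \<Rightarrow> nat ^ 'n) \<Rightarrow> (nat \<Rightarrow> 'w \<Rightarrow> 'n set) \<Rightarrow> (nat \<Rightarrow> 'w \<Rightarrow> 'n) \<Rightarrow>
   (nat \<Rightarrow> 'w \<Rightarrow> nat ^ 'n) \<Rightarrow> nat \<Rightarrow> 'w \<Rightarrow>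
   (nat ^ 'n) list \<times> (nat \<times> (nat ^ 'n) \<times> 'n set \<times> 'n) list" where
  "history a s sel dest q k \<omega> =
     (map (\<lambda>j. q j \<omega>) [0..<Suc k], map (\<lambda>j. (a j \<omega>, s j \<omega>, sel j \<omega>, dest j \<omega>)) [0..<k])"

locale power_of_d_choices = prob_space M
  for M :: "'w measure" +
  fixes d :: nat
    and a :: "nat \<Rightarrow> 'w \<Rightarrow> nat"
    and s :: "nat \<Rightarrow> 'w \<Rightarrow> nat ^ 'n::finite"
    and sel :: "nat \<Rightarrow> 'w \<Rightarrow> 'n set"
    and dest :: "nat \<Rightarrow> 'w \<Rightarrow> 'n"
    and q :: "nat \<Rightarrow> 'w \<Rightarrow> nat ^ 'n"
  assumes measurable_dest: "\<And>k. dest k \<in> measurable M (count_space UNIV)"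
      and measurable_q: "\<And>k. q k \<in> measurable M (count_space UNIV)"
      and iid_arrivals: "iid_seq M (count_space UNIV) a"
      and iid_services: "iid_seq M (count_space UNIV) s"
      and arrivals_indep_services:
        "independent M (\<Pi>\<^sub>M k\<in>UNIV. count_space UNIV) (\<lambda>\<omega> k. a k \<omega>)
                       (\<Pi>\<^sub>M k\<in>UNIV. count_space UNIV) (\<lambda>\<omega> k. s k \<omega>)"
      and current_indep_history:
        "\<And>k. independent M (count_space UNIV) (\<lambda>\<omega>. (a k \<omega>, s k \<omega>))
                           (count_space UNIV) (history a s sel dest q k)"
      and sel_uniform:
        "\<And>k. distr M (count_space UNIV) (sel k) = measure_pmf (pmf_of_set {D. card D = d})"
      and sel_indep:
        "\<And>k. independent M (count_space UNIV) (sel k)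
                (count_space UNIV) (\<lambda>\<omega>. (history a s sel dest q k \<omega>, a k \<omega>, s k \<omega>))"
      and dest_uniform_shortest:
        "\<And>k h v x y D i.
           prob {\<omega> \<in> space M. history a s sel dest q k \<omega> = h \<and> q k \<omega> = v \<and>
                              a k \<omega> = x \<and> s k \<omega> = y \<and> sel k \<omega> = D} > 0 \<Longrightarrow>
           \<P>(\<omega> in M. dest k \<omega> = i \<bar> history a s sel dest q k \<omega> = h \<and> q k \<omega> = v \<and>
                              a k \<omega> = x \<and> s k \<omega> = y \<and> sel k \<omega> = D)
             = pmf (pmf_of_set (shortest v D)) i"
      and queue_dynamics:
        "\<And>k \<omega> i. \<omega> \<in> space M \<Longrightarrow>
           int (q (Suc k) \<omega> $ i)
             = int (q k \<omega> $ i) + int (arrivals_at (a k \<omega>) (dest k \<omega>) i) - int (s k \<omega> $ i)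
               + unused_service (q k \<omega>) (a k \<omega>) (s k \<omega>) (dest k \<omega>) i"

end

theory Submission
  imports Defs "HOL-Real_Asymp.Real_Asymp"
begin

text \<open>
  The limit law of the queue lengths is a stationary distribution \<open>\<pi>\<close> of a Markov chain on the
  lattice. The interior condition makes the pairwise differences of the queue lengths drift
  towards zero at a rate that does not depend on \<open>\<epsilon>\<close>, so under \<open>\<pi>\<close> the second moment of these
  differences is bounded uniformly in \<open>\<epsilon>\<close>. Hence \<open>\<epsilon> q\<close> is asymptotically a multiple of the all-ones
  vector, and wasted service (which requires an empty queue) occurs only when the total queue length
  \<open>Q\<close> is of order one. Writing \<open>X\<close> for the net input and \<open>U\<close> for the wasted service of a slot,
  stationarity of \<open>exp (i \<tau> Q)\<close> gives
  \<open>\<phi> (E exp (i \<tau> X) - 1) = E exp (- i \<tau> U) - 1 + error\<close> with \<open>E U = \<epsilon>\<close>; at \<open>\<tau> = t \<epsilon> / n\<close>, dividing by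
  \<open>\<epsilon>\<^sup>2\<close> yields the characteristic function of the exponential distribution in the limit.
\<close>

subsection \<open>Spread of the queue lengths and its mean drift\<close>

text \<open>The binomial ratio in the capacity region is a probability: the arrivals join a queue
  longer than \<open>t\<close> exactly when all \<open>d\<close> sampled queues are longer than
  \<open>t\<close>. An interior point thus gives every nonempty proper set of servers a service
  surplus of at least some \<delta>, and summing over the levels \<open>t\<close> yields a restoring
  drift. A load deficit \<epsilon> up to \<delta> / 2 costs at most half of it, whence the
  uniformity.

  No moment of the steady state is given. So Lyapunov functions and the total queue length are
  truncated before stationarity is used, and the transform is a characteristic function, which
  always exists.

  Let \<open>m\<close> be the second moment of the net input. For \<tau> of order \<epsilon>, the
  mean term i \<tau> \<epsilon> and the fluctuation term \<tau>^2 m / 2 both have size \<epsilon>^2,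
  and \<phi> (i \<tau> \<epsilon> + \<tau>^2 m / 2) = i \<tau> \<epsilon> holds up to order
  \<epsilon>^(5/2). Solving for \<phi> at \<tau> = t \<epsilon> / n gives 1 / (1 - i t m / (2
  n)).\<close>

lemma integral_bind_pmf_bounded:
  fixes f :: "'b \<Rightarrow> real"
  assumes B: "\<And>x. x \<in> set_pmf (bind_pmf p g) \<Longrightarrow> \<bar>f x\<bar> \<le> B"
  shows "(\<integral>x. f x \<partial>bind_pmf p g) = (\<integral>y. (\<integral>x. f x \<partial>g y) \<partial>p)"
proof -
  \<comment> \<open>The exchange of integrals asks for a bound at every point, so \<open>f\<close>
    is set to 0 off the support, which changes neither side.\<close>
  define f' where "f' x = (if x \<in> set_pmf (bind_pmf p g) then f x else 0)" for x
  have "(\<integral>x. f x \<partial>bind_pmf p g) = (\<integral>x. f' x \<partial>bind_pmf p g)"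
    by (intro integral_cong_AE) (auto simp: f'_def AE_measure_pmf_iff)
  also have "\<dots> = (\<integral>y. (\<integral>x. f' x \<partial>g y) \<partial>p)"
    unfolding measure_pmf_bind
  proof (rule integral_bind[where K = "count_space UNIV" and B = "\<bar>B\<bar>" and B' = 1])
    show "\<bar>f' x\<bar> \<le> \<bar>B\<bar>" for x
      using B[of x] by (cases "x \<in> set_pmf (bind_pmf p g)") (simp_all add: f'_def del: set_bind_pmf)
    show "finite_measure (measure_pmf p)"
      by unfold_locales
  qed (auto simp: measure_subprob)
  also have "\<dots> = (\<integral>y. (\<integral>x. f x \<partial>g y) \<partial>p)"
  proof (rule integral_cong_AE)
    show "AE y in p. (\<integral>x. f' x \<partial>g y) = (\<integral>x. f x \<partial>g y)"
      by (rule AE_pmfI, rule integral_cong_AE) (auto simp: f'_def AE_measure_pmf_iff)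
  qed auto
  finally show ?thesis .
qed

lemma integrable_pmf_bounded:
  fixes f :: "'b \<Rightarrow> 'c::{banach, second_countable_topology}"
  assumes "\<And>x. x \<in> set_pmf p \<Longrightarrow> norm (f x) \<le> B"
  shows "integrable (measure_pmf p) f"
  by (rule measure_pmf.integrable_const_bound[where B = B]) (auto simp: AE_measure_pmf_iff assms)

lemma norm_integral_pmf_le:
  fixes f :: "'b \<Rightarrow> 'c::{banach, second_countable_topology}"
  assumes B: "\<And>x. x \<in> set_pmf p \<Longrightarrow> norm (f x) \<le> B"
  shows "norm (\<integral>x. f x \<partial>p) \<le> B"
proof -
  have "norm (\<integral>x. f x \<partial>p) \<le> (\<integral>x. norm (f x) \<partial>p)"
    by (rule integral_norm_bound)
  also have "\<dots> \<le> (\<integral>x. B \<partial>p)"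
    by (rule integral_mono_AE)
      (auto simp: AE_measure_pmf_iff B intro!: integrable_pmf_bounded[where B = B])
  finally show ?thesis by simp
qed

lemma integral_bind_pmf_bounded_complex:
  fixes f :: "'b \<Rightarrow> complex"
  assumes B: "\<And>x. x \<in> set_pmf (bind_pmf p g) \<Longrightarrow> norm (f x) \<le> B"
  shows "(\<integral>x. f x \<partial>bind_pmf p g) = (\<integral>y. (\<integral>x. f x \<partial>g y) \<partial>p)"
proof -
  have Re: "\<bar>Re (f x)\<bar> \<le> B" and Im: "\<bar>Im (f x)\<bar> \<le> B" if "x \<in> set_pmf (bind_pmf p g)" for x
    using B[OF that] abs_Re_le_cmod[of "f x"] abs_Im_le_cmod[of "f x"] by linarith+
  have int: "integrable (g y) f" if "y \<in> set_pmf p" for y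
    using that by (intro integrable_pmf_bounded[where B = B] B) auto
  have int1: "integrable (bind_pmf p g) f"
    by (intro integrable_pmf_bounded[where B = B] B)
  have int2: "integrable p (\<lambda>y. \<integral>x. f x \<partial>g y)"
    by (intro integrable_pmf_bounded[where B = B] norm_integral_pmf_le B) auto
  have "(\<integral>y. (\<integral>x. Re (f x) \<partial>g y) \<partial>p) = (\<integral>y. Re (\<integral>x. f x \<partial>g y) \<partial>p)"
    by (rule integral_cong_AE) (auto simp: AE_measure_pmf_iff int)
  moreover have "(\<integral>y. (\<integral>x. Im (f x) \<partial>g y) \<partial>p) = (\<integral>y. Im (\<integral>x. f x \<partial>g y) \<partial>p)"
    by (rule integral_cong_AE) (auto simp: AE_measure_pmf_iff int)
  ultimately show ?thesis
    using integral_bind_pmf_bounded[of p g "\<lambda>x. Re (f x)" B, OF Re]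
      integral_bind_pmf_bounded[of p g "\<lambda>x. Im (f x)" B, OF Im] int1 int2
    by (intro complex_eqI) (simp_all flip: integral_Re integral_Im)
qed

lemma pair_pmf_conv_bind_map: "pair_pmf p r = bind_pmf p (\<lambda>x. map_pmf (Pair x) r)"
  by (simp add: pair_pmf_def map_pmf_def)

lemma integral_pair_pmf_bounded:
  fixes f :: "'a \<times> 'b \<Rightarrow> real"
  assumes "\<And>x y. x \<in> set_pmf p \<Longrightarrow> y \<in> set_pmf r \<Longrightarrow> \<bar>f (x, y)\<bar> \<le> B"
  shows "(\<integral>z. f z \<partial>pair_pmf p r) = (\<integral>x. (\<integral>y. f (x, y) \<partial>r) \<partial>p)"
  unfolding pair_pmf_conv_bind_map by (subst integral_bind_pmf_bounded[where B = B]) (use assms in auto)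

text \<open>This is \<open>sqrt (2 * n)\<close> times the Euclidean distance from \<open>x\<close>
  to the multiples of the all-ones vector. In terms of differences it is evident that applying one
  1-Lipschitz function to all coordinates cannot increase it.\<close>

definition spread :: "('n::finite \<Rightarrow> real) \<Rightarrow> real" where
  "spread x = L2_set (\<lambda>(i, j). x i - x j) UNIV"

lemma spread_nonneg [simp]: "0 \<le> spread x"
  by (simp add: spread_def)

lemma spread_add_le: "spread (\<lambda>i. x i + y i) \<le> spread x + spread y"
proof -
  have "spread (\<lambda>i. x i + y i) = L2_set (\<lambda>z. (case z of (i, j) \<Rightarrow> x i - x j) + (case z of (i, j) \<Rightarrow> y i - y j)) UNIV"
    unfolding spread_def by (intro L2_set_cong) auto
  also have "\<dots> \<le> spread x + spread y"
    unfolding spread_def by (rule L2_set_triangle_ineq)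
  finally show ?thesis .
qed

lemma abs_diff_le_spread: "\<bar>x i - x j\<bar> \<le> spread x"
proof -
  have "spread x = L2_set (\<lambda>z. \<bar>case z of (i, j) \<Rightarrow> x i - x j\<bar>) UNIV"
    by (simp add: spread_def L2_set_def)
  then show ?thesis
    using member_le_L2_set[of UNIV "(i, j)" "\<lambda>z. \<bar>case z of (i, j) \<Rightarrow> x i - x j\<bar>"] by simp
qed

lemma spread_contraction:
  assumes "\<And>i j. \<bar>x i - x j\<bar> \<le> \<bar>y i - y j\<bar>"
  shows "spread x \<le> spread y"
proof -
  have *: "spread x = L2_set (\<lambda>z. \<bar>case z of (i, j) \<Rightarrow> x i - x j\<bar>) UNIV" for x :: "'a \<Rightarrow> real"
    by (simp add: spread_def L2_set_def)
  show ?thesis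
    unfolding * by (rule L2_set_mono) (use assms in auto)
qed

lemma spread_le_max_diff:
  fixes x :: "'n::finite \<Rightarrow> real"
  assumes "\<And>i j. \<bar>x i - x j\<bar> \<le> G"
  shows "spread x \<le> real CARD('n) * G"
proof -
  have "spread x = L2_set (\<lambda>z. \<bar>case z of (i, j) \<Rightarrow> x i - x j\<bar>) UNIV"
    by (simp add: spread_def L2_set_def)
  also have "\<dots> \<le> L2_set (\<lambda>z::'n \<times> 'n. G) UNIV"
    by (rule L2_set_mono) (use assms in auto)
  also have "\<dots> = real CARD('n) * G"
    using assms[of undefined undefined] by (simp add: L2_set_constant card_prod real_sqrt_mult)
  finally show ?thesis .
qed

lemma spread_le_bound:
  fixes x :: "'n::finite \<Rightarrow> real"
  assumes "\<And>i. \<bar>x i\<bar> \<le> b"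
  shows "spread x \<le> 2 * real CARD('n) * b"
proof -
  have "\<bar>x i - x j\<bar> \<le> 2 * b" for i j
    using assms[of i] assms[of j] by linarith
  from spread_le_max_diff[of x, OF this] show ?thesis by simp
qed

text \<open>Polarization of a quadratic form. In a queueing step \<open>z\<close> is the net input,
  so the cross term is the one that carries the drift.\<close>

lemma spread_add_square:
  fixes x z :: "'n::finite \<Rightarrow> real"
  shows "(spread (\<lambda>i. x i + z i))\<^sup>2 =
    (spread x)\<^sup>2 + 4 * (real CARD('n) * (\<Sum>i\<in>UNIV. x i * z i) - sum x UNIV * sum z UNIV) + (spread z)\<^sup>2"
proof -
  have sq: "(spread x)\<^sup>2 = (\<Sum>i\<in>UNIV. \<Sum>j\<in>UNIV. (x i - x j)\<^sup>2)" for x :: "'n \<Rightarrow> real"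
    unfolding spread_def L2_set_def
    by (simp add: sum_nonneg split_beta sum.cartesian_product flip: UNIV_Times_UNIV)
  have "(\<Sum>i\<in>UNIV. \<Sum>j\<in>UNIV. (x i - x j) * (z i - z j)) =
      (\<Sum>i\<in>UNIV. \<Sum>j\<in>(UNIV :: 'n set). x i * z i) + (\<Sum>i\<in>(UNIV :: 'n set). \<Sum>j\<in>UNIV. x j * z j)
      - (\<Sum>i\<in>UNIV. \<Sum>j\<in>UNIV. x i * z j) - (\<Sum>i\<in>UNIV. \<Sum>j\<in>UNIV. z i * x j)"
    by (simp add: algebra_simps sum.distrib sum_subtractf)
  also have "\<dots> = 2 * (real CARD('n) * (\<Sum>i\<in>UNIV. x i * z i) - sum x UNIV * sum z UNIV)"
    by (simp add: sum_distrib_left[symmetric] sum_distrib_right[symmetric])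
  finally have cross: "(\<Sum>i\<in>UNIV. \<Sum>j\<in>UNIV. (x i - x j) * (z i - z j)) =
     2 * (real CARD('n) * (\<Sum>i\<in>UNIV. x i * z i) - sum x UNIV * sum z UNIV)" .
  have "((x i + z i) - (x j + z j))\<^sup>2 = (x i - x j)\<^sup>2 + 2 * ((x i - x j) * (z i - z j)) + (z i - z j)\<^sup>2" for i j
    by (simp add: power2_eq_square algebra_simps)
  then show ?thesis
    unfolding sq using cross by (simp add: sum.distrib flip: sum_distrib_left)
qed

text \<open>Layer-cake summation: \<open>v i\<close> is the number of levels \<open>t\<close> below
  it.\<close>

lemma weighted_sum_by_levels:
  fixes v :: "'n::finite \<Rightarrow> nat" and c :: "'n \<Rightarrow> real"
  assumes "\<And>i. v i \<le> L"
  shows "(\<Sum>i\<in>UNIV. c i * real (v i)) = (\<Sum>t<L. \<Sum>i\<in>{i. t < v i}. c i)"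
proof -
  have "real (v i) = (\<Sum>t<L. if t < v i then 1 else 0)" for i
  proof -
    have "{t \<in> {..<L}. t < v i} = {..<v i}"
      using assms[of i] by auto
    then show ?thesis
      by (simp flip: sum.inter_filter)
  qed
  then have "(\<Sum>i\<in>UNIV. c i * real (v i)) = (\<Sum>i\<in>UNIV. \<Sum>t<L. if t < v i then c i else 0)"
    by (simp add: sum_distrib_left if_distrib[of "\<lambda>x. _ * x"] cong: if_cong)
  also have "\<dots> = (\<Sum>t<L. \<Sum>i\<in>UNIV. if t < v i then c i else 0)"
    by (rule sum.swap)
  also have "\<dots> = (\<Sum>t<L. \<Sum>i\<in>{i. t < v i}. c i)"
    by (simp add: sum.If_cases)
  finally show ?thesis .
qed

section \<open>Law of the sampled destination\<close>

lemma shortest_nonempty: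
  assumes "D \<noteq> {}"
  shows "shortest v D \<noteq> {}"
proof -
  obtain i where "i \<in> D" "v $ i = Min ((\<lambda>i. v $ i) ` D)"
    using Min_in[of "(\<lambda>i. v $ i) ` D"] assms by fastforce
  then have "i \<in> shortest v D"
    by (auto simp: shortest_def)
  then show ?thesis by auto
qed

definition dest_pmf :: "nat \<Rightarrow> nat ^ 'n::finite \<Rightarrow> 'n pmf" where
  "dest_pmf d v = bind_pmf (pmf_of_set {D. card D = d}) (\<lambda>D. pmf_of_set (shortest v D))"

lemma sampled_sets:
  assumes "d \<le> CARD('n::finite)"
  shows "{D :: 'n set. card D = d} \<noteq> {}" "card {D :: 'n set. card D = d} = CARD('n) choose d"
proof -
  show "card {D :: 'n set. card D = d} = CARD('n) choose d"
    using n_subsets[of "UNIV :: 'n set" d] by simp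
  show "{D :: 'n set. card D = d} \<noteq> {}"
    using obtain_subset_with_card_n[of d "UNIV :: 'n set"] assms by auto
qed

text \<open>The shortest sampled queue is longer than \<open>t\<close> exactly when the whole sample
  lies in the level set, so the right side counts samples inside it. Tie-breaking drops out, since
  tied queues lie in the same level sets.\<close>

lemma sum_dest_pmf_level:
  fixes v :: "nat ^ 'n::finite"
  assumes d: "0 < d" "d \<le> CARD('n)"
  shows "(\<Sum>i\<in>{i. t < v $ i}. pmf (dest_pmf d v) i)
    = real (card {i. t < v $ i} choose d) / real (CARD('n) choose d)"
proof -
  let ?H = "{i. t < v $ i}" and ?C = "{D :: 'n set. card D = d}"
  note C = sampled_sets[OF d(2)]
  have fin: "finite ?C" by simp
  have level: "measure (pmf_of_set (shortest v D)) ?H = indicator {D. D \<subseteq> ?H} D" if "D \<in> ?C" for D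
  proof -
    have "D \<noteq> {}" using that d by auto
    from shortest_nonempty[OF this] have ne: "shortest v D \<noteq> {}" .
    show ?thesis
    proof (cases "D \<subseteq> ?H")
      case True
      then have "shortest v D \<inter> ?H = shortest v D"
        by (auto simp: shortest_def)
      then show ?thesis using True ne by (simp add: measure_pmf_of_set)
    next
      case False
      then obtain j where j: "j \<in> D" "\<not> t < v $ j" by blast
      have "v $ i \<le> t" if "i \<in> shortest v D" for i
        using that j by (auto simp: shortest_def dest!: bspec[of D _ j])
      then have "shortest v D \<inter> ?H = {}"
        by (force simp: not_less[symmetric])
      then show ?thesis using False ne by (simp add: measure_pmf_of_set)
    qed
  qed
  have "(\<Sum>i\<in>?H. pmf (dest_pmf d v) i) = (\<integral>i. indicator ?H i \<partial>dest_pmf d v)"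
    by (simp add: measure_measure_pmf_finite)
  also have "\<dots> = (\<integral>D. measure (pmf_of_set (shortest v D)) ?H \<partial>pmf_of_set ?C)"
    unfolding dest_pmf_def by (subst integral_bind_pmf_bounded[where B = 1]) (auto split: split_indicator)
  also have "\<dots> = (\<Sum>D\<in>?C. measure (pmf_of_set (shortest v D)) ?H) / card ?C"
    using C fin by (intro integral_pmf_of_set)
  also have "(\<Sum>D\<in>?C. measure (pmf_of_set (shortest v D)) ?H) = (\<Sum>D\<in>?C. indicator {D. D \<subseteq> ?H} D)"
    by (intro sum.cong refl level)
  also have "\<dots> = card {D. D \<subseteq> ?H \<and> card D = d}"
    by (simp add: indicator_def sum.If_cases Collect_conj_eq Int_commute)
  also have "\<dots> = (card ?H choose d)"
    by (simp add: n_subsets)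
  finally show ?thesis using C by simp
qed

text \<open>Decomposing queue lengths into their level sets \<open>{i. t < v $ i}\<close> reduces the inner product to
  the capacity inequality for each level set.\<close>

lemma inner_drift_le:
  fixes v :: "nat ^ 'n::finite" and \<mu> :: "real ^ 'n"
  assumes d: "0 < d" "d \<le> CARD('n)"
    and margin: "\<And>H. H \<noteq> {} \<Longrightarrow> H \<noteq> UNIV \<Longrightarrow>
      (\<Sum>i\<in>UNIV. \<mu> $ i) * (real (card H choose d) / real (CARD('n) choose d)) + \<delta> \<le> (\<Sum>i\<in>H. \<mu> $ i)"
    and \<epsilon>: "0 < \<epsilon>" "\<epsilon> \<le> \<delta> / 2"
  defines "lam \<equiv> (\<Sum>i\<in>UNIV. \<mu> $ i) - \<epsilon>"
  shows "real CARD('n) * (\<Sum>i\<in>UNIV. real (v $ i) * (lam * pmf (dest_pmf d v) i - \<mu> $ i))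
     + \<epsilon> * (\<Sum>i\<in>UNIV. real (v $ i)) \<le> - (\<delta> / 2) * spread (\<lambda>i. real (v $ i))"
proof -
  let ?n = "real CARD('n)" and ?\<mu> = "\<Sum>i\<in>UNIV. \<mu> $ i"
  \<comment> \<open>The shift by \<epsilon> absorbs the term with the total queue length, so the
    left side of the claim becomes one weighted sum.\<close>
  define c where "c i = ?n * (lam * pmf (dest_pmf d v) i - \<mu> $ i) + \<epsilon>" for i
  define L where "L = Max (range (\<lambda>i. v $ i))"
  define l where "l = Min (range (\<lambda>i. v $ i))"
  have L: "v $ i \<le> L" and l: "l \<le> v $ i" for i
    by (simp_all add: L_def l_def)
  have lL: "l \<le> L" using L l le_trans by blast
  have level: "(\<Sum>i\<in>{i. t < v $ i}. c i) \<le> (if t < l then 0 else - ?n * (\<delta> / 2))" if t: "t < L" for t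
  proof -
    let ?H = "{i. t < v $ i}"
    let ?r = "real (card ?H choose d) / real (CARD('n) choose d)"
    have sum_c: "(\<Sum>i\<in>?H. c i) = ?n * (lam * ?r - (\<Sum>i\<in>?H. \<mu> $ i)) + \<epsilon> * card ?H"
      by (simp add: c_def sum.distrib sum_subtractf sum_dest_pmf_level[OF d, symmetric]
          flip: sum_distrib_left)
    show ?thesis
    proof (cases "t < l")
      case True
      \<comment> \<open>Every queue is above this level, so every sample lies in \<open>?H\<close>;
        the load deficit, multiplied by \<open>n\<close>, cancels against the shift.\<close>
      then have H: "?H = UNIV" using l by (auto intro: less_le_trans)
      have "(CARD('n) choose d) \<noteq> 0" using d by simp
      then show ?thesis using True sum_c unfolding H by (simp add: lam_def algebra_simps)
    next
      case False
      have "L \<in> range (\<lambda>i. v $ i)" "l \<in> range (\<lambda>i. v $ i)"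
        unfolding L_def l_def by (intro Max_in Min_in; simp)+
      then have "?H \<noteq> {}" "?H \<noteq> UNIV"
        using t False by auto
      from margin[OF this] have m: "?\<mu> * ?r + \<delta> \<le> (\<Sum>i\<in>?H. \<mu> $ i)" .
      have "lam * ?r \<le> ?\<mu> * ?r"
        using \<epsilon> by (intro mult_right_mono) (auto simp: lam_def)
      with m have "lam * ?r - (\<Sum>i\<in>?H. \<mu> $ i) \<le> - \<delta>" by linarith
      then have "?n * (lam * ?r - (\<Sum>i\<in>?H. \<mu> $ i)) \<le> ?n * (- \<delta>)"
        by (intro mult_left_mono) auto
      \<comment> \<open>The shift consumes at most half of the margin; this is where \<epsilon>
        \<le> \<delta> / 2 is used.\<close>
      moreover have "\<epsilon> * card ?H \<le> \<delta> / 2 * ?n"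
        using \<epsilon> by (intro mult_mono) (auto intro!: card_mono)
      ultimately show ?thesis using False sum_c by (simp add: algebra_simps)
    qed
  qed
  have "?n * (\<Sum>i\<in>UNIV. real (v $ i) * (lam * pmf (dest_pmf d v) i - \<mu> $ i)) + \<epsilon> * (\<Sum>i\<in>UNIV. real (v $ i))
      = (\<Sum>i\<in>UNIV. c i * real (v $ i))"
    by (simp add: c_def sum_distrib_left flip: sum.distrib) (simp add: algebra_simps)
  also have "\<dots> = (\<Sum>t<L. \<Sum>i\<in>{i. t < v $ i}. c i)"
    by (rule weighted_sum_by_levels) (rule L)
  also have "\<dots> \<le> (\<Sum>t<L. if t < l then 0 else - ?n * (\<delta> / 2))"
    by (intro sum_mono level) simp
  also have "\<dots> = (\<Sum>t\<in>{l..<L}. - ?n * (\<delta> / 2))"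
    by (rule sum.mono_neutral_cong_right) auto
  also have "\<dots> = - (\<delta> / 2) * (?n * (real L - real l))"
    using lL by (simp add: of_nat_diff)
  also have "\<dots> \<le> - (\<delta> / 2) * spread (\<lambda>i. real (v $ i))"
  proof -
    \<comment> \<open>Each of the \<open>L - l\<close> levels that separate some queues contributes
      the same negative amount, and their number times \<open>n\<close> dominates the
      spread.\<close>
    have "spread (\<lambda>i. real (v $ i)) \<le> ?n * (real L - real l)"
    proof (rule spread_le_max_diff)
      show "\<bar>real (v $ i) - real (v $ j)\<bar> \<le> real L - real l" for i j
        using L[of i] L[of j] l[of i] l[of j] by linarith
    qed
    with \<epsilon> show ?thesis by (intro mult_left_mono_neg) auto
  qed
  finally show ?thesis .
qed

subsection \<open>Exponential Lyapunov functions\<close>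

lemma exp_le_quadratic:
  fixes x :: real
  assumes "\<bar>x\<bar> \<le> 1"
  shows "exp x \<le> 1 + x + x\<^sup>2"
proof (cases "0 \<le> x")
  case True
  with assms show ?thesis by (intro exp_bound) auto
next
  case False
  define y where "y = - x"
  have y: "0 \<le> y" using False by (simp add: y_def)
  \<comment> \<open>After multiplication by \<open>exp y\<close> the claim says that a product is at
    least 1, and replacing \<open>exp y\<close> by its quadratic Taylor polynomial already
    suffices.\<close>
  have "1 \<le> 1 + y\<^sup>2 / 2 + y ^ 3 / 2 + y ^ 4 / 2" using y by simp
  also have "\<dots> = (1 - y + y\<^sup>2) * (1 + y + y\<^sup>2 / 2)"
    by (simp add: field_simps power2_eq_square power3_eq_cube eval_nat_numeral)
  also have "\<dots> \<le> (1 - y + y\<^sup>2) * exp y"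
  proof (rule mult_left_mono)
    show "1 + y + y\<^sup>2 / 2 \<le> exp y" using y by (rule exp_lower_Taylor_quadratic)
    show "0 \<le> 1 - y + y\<^sup>2" using assms y_def by simp
  qed
  finally have "exp (- y) \<le> 1 - y + y\<^sup>2"
    by (simp add: exp_minus field_simps)
  then show ?thesis by (simp add: y_def)
qed

text \<open>The exponential Lyapunov function is truncated at a level \<open>L\<close>, because no moment of the
  stationary distribution is known to be finite beforehand; truncation preserves negative drift
  since \<open>min _ L\<close> is concave.\<close>

lemma stationary_second_moment_bound:
  fixes J \<eta> B :: real
  assumes J: "0 < J" and \<eta>: "0 < \<eta>"
  obtains C where "0 \<le> C"
    "\<And>(\<pi> :: 'a pmf) K (W :: 'a \<Rightarrow> real). \<pi> = bind_pmf \<pi> K \<Longrightarrow> (\<And>v. 0 \<le> W v) \<Longrightarrow>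
      (\<And>v w. w \<in> set_pmf (K v) \<Longrightarrow> \<bar>W w - W v\<bar> \<le> J) \<Longrightarrow>
      (\<And>v. B \<le> W v \<Longrightarrow> (\<integral>w. W w - W v \<partial>K v) \<le> - \<eta>) \<Longrightarrow>
      integrable \<pi> (\<lambda>v. (W v)\<^sup>2) \<and> (\<integral>v. (W v)\<^sup>2 \<partial>\<pi>) \<le> C"
proof
  \<comment> \<open>The first bound keeps the exponents in the range of
    \<open>exp_le_quadratic\<close>; the second makes the quadratic term at most half of the linear
    gain \<open>\<theta> * \<eta>\<close>, and \<rho> is the remaining half. These constants depend
    on \<open>J\<close>, \<eta> and \<open>B\<close> alone, so the bound is uniform over all
    chains.\<close>
  define \<theta> where "\<theta> = min (1 / J) (\<eta> / (2 * J\<^sup>2))"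
  define \<rho> where "\<rho> = \<theta> * \<eta> / 2"
  \<comment> \<open>The price of the states with \<open>W v < B\<close>, where no drift is assumed:
    the largest value after one jump, plus the \<rho>-term that appears on the left side of the
    estimate.\<close>
  define D where "D = exp (\<theta> * (B + J)) + \<rho> * exp (\<theta> * B)"
  have \<theta>: "0 < \<theta>" using J \<eta> by (simp add: \<theta>_def)
  have \<theta>J: "\<theta> * J \<le> 1" using J by (simp add: \<theta>_def min_def field_simps)
  have "\<theta> * J\<^sup>2 \<le> \<eta> / (2 * J\<^sup>2) * J\<^sup>2"
    by (intro mult_right_mono) (auto simp: \<theta>_def)
  then have \<theta>\<eta>: "\<theta> * J\<^sup>2 \<le> \<eta> / 2" using J by simp
  have \<rho>: "0 < \<rho>" using \<theta> \<eta> by (simp add: \<rho>_def)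
  have D: "0 \<le> D" using \<rho> by (simp add: D_def)
  show "0 \<le> 2 / \<theta>\<^sup>2 * (D / \<rho>)" using D \<rho> by simp
  fix \<pi> :: "'a pmf" and K and W :: "'a \<Rightarrow> real"
  assume stat: "\<pi> = bind_pmf \<pi> K" and W0: "\<And>v. 0 \<le> W v"
    and jump: "\<And>v w. w \<in> set_pmf (K v) \<Longrightarrow> \<bar>W w - W v\<bar> \<le> J"
    and drift: "\<And>v. B \<le> W v \<Longrightarrow> (\<integral>w. W w - W v \<partial>K v) \<le> - \<eta>"
  have int_exp: "integrable (K v) (\<lambda>w. exp (\<theta> * W w))" for v
    by (rule integrable_pmf_bounded[where B = "exp (\<theta> * (W v + J))"]) (auto simp: \<theta> dest!: jump)
  have exp_drift: "(\<integral>w. exp (\<theta> * W w) \<partial>K v) \<le> exp (\<theta> * W v) * (1 - \<rho>)" if v: "B \<le> W v" for v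
  proof -
    have small: "\<bar>\<theta> * (W w - W v)\<bar> \<le> 1" if "w \<in> set_pmf (K v)" for w
    proof -
      have "\<bar>\<theta> * (W w - W v)\<bar> = \<theta> * \<bar>W w - W v\<bar>" using \<theta> by (simp add: abs_mult)
      also have "\<dots> \<le> \<theta> * J" using jump[OF that] \<theta> by simp
      finally show ?thesis using \<theta>J by linarith
    qed
    have int: "integrable (K v) (\<lambda>w. W w - W v)"
      by (rule integrable_pmf_bounded[where B = J]) (simp add: jump)
    have "exp (\<theta> * W w) \<le> exp (\<theta> * W v) * (1 + \<theta> * (W w - W v) + \<theta>\<^sup>2 * J\<^sup>2)"
      if w: "w \<in> set_pmf (K v)" for w
    proof -
      have "exp (\<theta> * W w) = exp (\<theta> * W v) * exp (\<theta> * (W w - W v))"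
        by (simp add: algebra_simps flip: exp_add)
      also have "exp (\<theta> * (W w - W v)) \<le> 1 + \<theta> * (W w - W v) + (\<theta> * (W w - W v))\<^sup>2"
        by (rule exp_le_quadratic[OF small[OF w]])
      also have "(\<theta> * (W w - W v))\<^sup>2 \<le> \<theta>\<^sup>2 * J\<^sup>2"
        unfolding power_mult_distrib using jump[OF w] J
        by (intro mult_left_mono) (auto simp: abs_le_square_iff[symmetric])
      finally show ?thesis by simp
    qed
    then have "(\<integral>w. exp (\<theta> * W w) \<partial>K v) \<le> (\<integral>w. exp (\<theta> * W v) * (1 + \<theta> * (W w - W v) + \<theta>\<^sup>2 * J\<^sup>2) \<partial>K v)"
      using int by (intro integral_mono_AE int_exp) (auto simp: AE_measure_pmf_iff)
    also have "\<dots> = exp (\<theta> * W v) * (1 + \<theta> * (\<integral>w. W w - W v \<partial>K v) + \<theta>\<^sup>2 * J\<^sup>2)"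
      using int by simp
    also have "\<dots> \<le> exp (\<theta> * W v) * (1 - \<rho>)"
    proof (rule mult_left_mono)
      have "\<theta> * (\<integral>w. W w - W v \<partial>K v) \<le> \<theta> * (- \<eta>)"
        using drift[OF v] \<theta> by (intro mult_left_mono) auto
      moreover have "\<theta>\<^sup>2 * J\<^sup>2 \<le> \<theta> * (\<eta> / 2)"
        using mult_left_mono[OF \<theta>\<eta>, of \<theta>] \<theta> by (simp add: power2_eq_square mult.assoc)
      ultimately show "1 + \<theta> * (\<integral>w. W w - W v \<partial>K v) + \<theta>\<^sup>2 * J\<^sup>2 \<le> 1 - \<rho>"
        by (simp add: \<rho>_def)
    qed simp
    finally show ?thesis .
  qed
  have trunc: "\<rho> * (\<integral>v. (if exp (\<theta> * W v) \<le> L then exp (\<theta> * W v) else 0) \<partial>\<pi>) \<le> D" if L: "0 < L" for L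
  proof -
    let ?E = "\<lambda>v. exp (\<theta> * W v)"
    define g where "g v = min (?E v) L" for v
    have g: "0 \<le> g v" "g v \<le> L" "g v \<le> ?E v" for v using L by (auto simp: g_def)
    have int_g: "integrable (measure_pmf p) g" for p
      by (rule integrable_pmf_bounded[where B = L]) (use g in auto)
    have Kg: "0 \<le> (\<integral>w. g w \<partial>K v)" "(\<integral>w. g w \<partial>K v) \<le> L" for v
      using g int_g by (auto intro!: measure_pmf.integral_le_const)
    have int_Kg: "integrable \<pi> (\<lambda>v. \<integral>w. g w \<partial>K v)"
      by (rule integrable_pmf_bounded[where B = L]) (use Kg in auto)
    have int_E: "integrable \<pi> (\<lambda>v. if ?E v \<le> L then ?E v else 0)"
      by (rule integrable_pmf_bounded[where B = L]) (use L in auto)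
    have pw: "\<rho> * (if ?E v \<le> L then ?E v else 0) - D \<le> g v - (\<integral>w. g w \<partial>K v)" for v
    proof (cases "?E v \<le> L")
      case False
      \<comment> \<open>Above the truncation level \<open>g\<close> is at its maximum and cannot
        increase in mean.\<close>
      then have "g v = L" by (simp add: g_def)
      with False D Kg[of v] show ?thesis by simp
    next
      case le: True
      have Kg_le: "(\<integral>w. g w \<partial>K v) \<le> (\<integral>w. ?E w \<partial>K v)"
        by (intro integral_mono int_g int_exp g)
      have gv: "g v = ?E v" using le by (simp add: g_def)
      show ?thesis
      proof (cases "B \<le> W v")
        case True
        from exp_drift[OF this] Kg_le le D show ?thesis by (simp add: gv algebra_simps)
      next
        case False
        have "(\<integral>w. ?E w \<partial>K v) \<le> exp (\<theta> * (B + J))"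
          using False \<theta> by (intro measure_pmf.integral_le_const int_exp AE_pmfI) (auto dest!: jump)
        moreover have "\<rho> * ?E v \<le> \<rho> * exp (\<theta> * B)"
          using False \<theta> \<rho> by simp
        ultimately show ?thesis
          using Kg_le le g(1)[of v] unfolding D_def by simp
      qed
    qed
    have "\<rho> * (\<integral>v. (if ?E v \<le> L then ?E v else 0) \<partial>\<pi>) - D = (\<integral>v. \<rho> * (if ?E v \<le> L then ?E v else 0) - D \<partial>\<pi>)"
      using int_E by simp
    also have "\<dots> \<le> (\<integral>v. g v - (\<integral>w. g w \<partial>K v) \<partial>\<pi>)"
      using int_E int_g int_Kg pw by (intro integral_mono) auto
    also have "\<dots> = (\<integral>v. g v \<partial>\<pi>) - (\<integral>v. (\<integral>w. g w \<partial>K v) \<partial>\<pi>)"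
      using int_g int_Kg by simp
    \<comment> \<open>Stationarity enters here; boundedness of \<open>g\<close> is what justifies
      it.\<close>
    also have "(\<integral>v. (\<integral>w. g w \<partial>K v) \<partial>\<pi>) = (\<integral>v. g v \<partial>\<pi>)"
      using g by (subst (2) stat, subst integral_bind_pmf_bounded[where B = L]) auto
    finally show ?thesis by simp
  qed
  \<comment> \<open>\<open>Suc L\<close> keeps the cutoff positive, as \<open>trunc\<close>
    requires. The functions \<open>f L\<close> increase to the square of \<open>W\<close>, so
    monotone convergence gives both integrability and the bound.\<close>
  define f where "f L v = (if exp (\<theta> * W v) \<le> real (Suc L) then (W v)\<^sup>2 else 0)" for L v
  have f_le: "f L v \<le> 2 / \<theta>\<^sup>2 * (if exp (\<theta> * W v) \<le> real (Suc L) then exp (\<theta> * W v) else 0)" for L v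
  proof -
    have "(\<theta> * W v)\<^sup>2 / 2 \<le> exp (\<theta> * W v)"
      using exp_lower_Taylor_quadratic[of "\<theta> * W v"] \<theta> W0[of v] by (smt (verit) mult_nonneg_nonneg)
    then have "(W v)\<^sup>2 \<le> 2 / \<theta>\<^sup>2 * exp (\<theta> * W v)"
      using \<theta> by (simp add: field_simps power_mult_distrib)
    then show ?thesis by (simp add: f_def)
  qed
  have int_f: "integrable \<pi> (f L)" for L
  proof (rule integrable_pmf_bounded)
    show "norm (f L v) \<le> 2 / \<theta>\<^sup>2 * real (Suc L)" for v
    proof -
      have "f L v \<le> 2 / \<theta>\<^sup>2 * real (Suc L)"
        by (rule order.trans[OF f_le], rule mult_left_mono) auto
      moreover have "0 \<le> f L v" by (simp add: f_def)
      ultimately show ?thesis by simp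
    qed
  qed
  have bound: "(\<integral>v. f L v \<partial>\<pi>) \<le> 2 / \<theta>\<^sup>2 * (D / \<rho>)" for L
  proof -
    have "(\<integral>v. f L v \<partial>\<pi>) \<le> (\<integral>v. 2 / \<theta>\<^sup>2 * (if exp (\<theta> * W v) \<le> real (Suc L) then exp (\<theta> * W v) else 0) \<partial>\<pi>)"
      by (intro integral_mono int_f f_le integrable_mult_right integrable_pmf_bounded[where B = "real (Suc L)"]) auto
    also have "\<dots> = 2 / \<theta>\<^sup>2 * (\<integral>v. (if exp (\<theta> * W v) \<le> real (Suc L) then exp (\<theta> * W v) else 0) \<partial>\<pi>)"
      by simp
    also have "\<dots> \<le> 2 / \<theta>\<^sup>2 * (D / \<rho>)"
      using trunc[of "real (Suc L)"] \<rho> by (intro mult_left_mono) (auto simp: field_simps)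
    finally show ?thesis .
  qed
  have mono: "f L v \<le> f L' v" if "L \<le> L'" for L L' v
    using that by (auto simp: f_def)
  have "incseq (\<lambda>L. \<integral>v. f L v \<partial>\<pi>)"
    by (intro incseq_SucI integral_mono int_f mono) auto
  then obtain l where l: "(\<lambda>L. \<integral>v. f L v \<partial>\<pi>) \<longlonglongrightarrow> l"
    using incseq_convergent[of _ "2 / \<theta>\<^sup>2 * (D / \<rho>)"] bound by metis
  have lim: "(\<lambda>L. f L v) \<longlonglongrightarrow> (W v)\<^sup>2" for v
  proof (rule tendsto_eventually)
    obtain k where k: "exp (\<theta> * W v) \<le> real k" using real_arch_simple by blast
    show "\<forall>\<^sub>F L in sequentially. f L v = (W v)\<^sup>2"
      using eventually_ge_at_top[of k] by eventually_elim (use k in \<open>auto simp: f_def\<close>)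
  qed
  have "mono (\<lambda>L. f L v)" for v
    by (intro monoI mono)
  then have "has_bochner_integral \<pi> (\<lambda>v. (W v)\<^sup>2) l"
    using lim l by (intro has_bochner_integral_monotone_convergence[where f = f] int_f) auto
  moreover have "l \<le> 2 / \<theta>\<^sup>2 * (D / \<rho>)"
    by (rule LIMSEQ_le_const2[OF l]) (use bound in auto)
  ultimately show "integrable \<pi> (\<lambda>v. (W v)\<^sup>2) \<and> (\<integral>v. (W v)\<^sup>2 \<partial>\<pi>) \<le> 2 / \<theta>\<^sup>2 * (D / \<rho>)"
    by (simp add: has_bochner_integral_iff)
qed

subsection \<open>State space collapse\<close>

definition slot_pmf :: "nat pmf \<Rightarrow> (nat ^ 'n::finite) pmf \<Rightarrow> nat \<Rightarrow> nat ^ 'n \<Rightarrow> (nat \<times> (nat ^ 'n) \<times> 'n) pmf" where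
  "slot_pmf A S d v = pair_pmf A (pair_pmf S (dest_pmf d v))"

text \<open>Truncated subtraction on \<open>nat\<close> plays the role of the unused service.\<close>

definition next_queue :: "nat ^ 'n::finite \<Rightarrow> nat \<times> (nat ^ 'n) \<times> 'n \<Rightarrow> nat ^ 'n" where
  "next_queue v = (\<lambda>(x, y, i). \<chi> j. v $ j + arrivals_at x i j - y $ j)"

definition unused_total :: "nat ^ 'n::finite \<Rightarrow> nat \<times> (nat ^ 'n) \<times> 'n \<Rightarrow> nat" where
  "unused_total v = (\<lambda>(x, y, i). \<Sum>j\<in>UNIV. y $ j - (v $ j + arrivals_at x i j))"

definition netput :: "nat \<times> (nat ^ 'n::finite) \<times> 'n \<Rightarrow> 'n \<Rightarrow> real" where
  "netput = (\<lambda>(x, y, i) j. real (arrivals_at x i j) - real (y $ j))"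

definition kernel :: "nat pmf \<Rightarrow> (nat ^ 'n::finite) pmf \<Rightarrow> nat \<Rightarrow> nat ^ 'n \<Rightarrow> (nat ^ 'n) pmf" where
  "kernel A S d v = map_pmf (next_queue v) (slot_pmf A S d v)"

abbreviation queue_spread :: "nat ^ 'n::finite \<Rightarrow> real" where
  "queue_spread v \<equiv> spread (\<lambda>i. real (v $ i))"

abbreviation queue_total :: "nat ^ 'n::finite \<Rightarrow> real" where
  "queue_total v \<equiv> \<Sum>i\<in>UNIV. real (v $ i)"

lemma next_queue_nth: "real (next_queue v \<omega> $ j) = max (real (v $ j) + netput \<omega> j) 0"
  by (auto simp: next_queue_def netput_def split_beta)

lemma sum_arrivals_at: "(\<Sum>j\<in>UNIV. arrivals_at x i (j :: 'n::finite)) = x"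
  by (simp add: arrivals_at_def)

lemma queue_total_next:
  fixes v :: "nat ^ 'n::finite"
  shows "queue_total (next_queue v (x, y, i)) = queue_total v + (real x - queue_total y) + real (unused_total v (x, y, i))"
proof -
  have "real (next_queue v (x, y, i) $ j) =
      real (v $ j) + real (arrivals_at x i j) - real (y $ j) + real (y $ j - (v $ j + arrivals_at x i j))" for j
    by (simp add: next_queue_def)
  moreover have "(\<Sum>j\<in>UNIV. real (arrivals_at x i (j :: 'n))) = real x"
    by (simp add: sum_arrivals_at flip: of_nat_sum)
  ultimately show ?thesis
    by (simp add: sum.distrib sum_subtractf unused_total_def)
qed

text \<open>Service can be wasted only at a queue that is empty afterwards, so the total queue length is
  then controlled by the spread.\<close>

lemma queue_total_le_spread_if_unused:
  fixes v :: "nat ^ 'n::finite"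
  assumes "unused_total v \<omega> \<noteq> 0"
  shows "queue_total (next_queue v \<omega>) \<le> real CARD('n) * queue_spread (next_queue v \<omega>)"
proof -
  obtain x y i where \<omega>: "\<omega> = (x, y, i)" by (cases \<omega>)
  obtain k where "y $ k - (v $ k + arrivals_at x i k) \<noteq> 0"
    using assms by (auto simp: unused_total_def \<omega>)
  then have "next_queue v \<omega> $ k = 0"
    by (simp add: next_queue_def \<omega>)
  then have "real (next_queue v \<omega> $ j) \<le> queue_spread (next_queue v \<omega>)" for j
    using abs_diff_le_spread[of "\<lambda>i. real (next_queue v \<omega> $ i)" j k] by simp
  then show ?thesis
    using sum_bounded_above[of UNIV "\<lambda>j. real (next_queue v \<omega> $ j)"] by simp
qed

locale load_balancer =
  fixes A :: "nat pmf" and S :: "(nat ^ 'n::finite) pmf" and d b :: nat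
  assumes d_pos: "0 < d" and d_le: "d \<le> CARD('n)"
    and A_le: "\<And>x. x \<in> set_pmf A \<Longrightarrow> x \<le> b"
    and S_le: "\<And>y i. y \<in> set_pmf S \<Longrightarrow> y $ i \<le> b"
begin

abbreviation "\<mu> \<equiv> \<lambda>i. \<integral>y. real (y $ i) \<partial>S"

abbreviation "mean_arrivals \<equiv> \<integral>x. real x \<partial>A"

lemma set_slot_pmf: "set_pmf (slot_pmf A S d v) = set_pmf A \<times> set_pmf S \<times> set_pmf (dest_pmf d v)"
  by (simp add: slot_pmf_def)

lemma abs_netput_le:
  assumes "\<omega> \<in> set_pmf (slot_pmf A S d v)"
  shows "\<bar>netput \<omega> j\<bar> \<le> b"
proof -
  obtain x y i where \<omega>: "\<omega> = (x, y, i)" "x \<le> b" "y $ j \<le> b"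
    using assms A_le S_le by (cases \<omega>) (auto simp: set_slot_pmf)
  then have "real (arrivals_at x i j) \<le> b" "real (y $ j) \<le> b"
    by (auto simp: arrivals_at_def)
  then show ?thesis by (auto simp: netput_def \<omega>(1))
qed

lemma unused_total_le:
  assumes "\<omega> \<in> set_pmf (slot_pmf A S d v)"
  shows "real (unused_total v \<omega>) \<le> real CARD('n) * b"
proof -
  obtain x y i where \<omega>: "\<omega> = (x, y, i)" "\<And>j. y $ j \<le> b"
    using assms S_le by (cases \<omega>) (auto simp: set_slot_pmf)
  have "unused_total v \<omega> \<le> (\<Sum>j\<in>(UNIV :: 'n set). b)"
    unfolding unused_total_def \<omega>(1) split by (intro sum_mono order.trans[OF diff_le_self \<omega>(2)])
  then have "unused_total v \<omega> \<le> CARD('n) * b" by simp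
  then show ?thesis
    unfolding of_nat_mult[symmetric] of_nat_le_iff .
qed

lemma queue_total_service_le: "y \<in> set_pmf S \<Longrightarrow> queue_total y \<le> real CARD('n) * b"
  using sum_bounded_above[of UNIV "\<lambda>j. real (y $ j)" "real b"] S_le by simp

lemma abs_net_total_le:
  assumes "x \<in> set_pmf A" "y \<in> set_pmf S"
  shows "\<bar>real x - queue_total y\<bar> \<le> real CARD('n) * b"
proof -
  have "real x \<le> 1 * real b" using A_le[OF assms(1)] by simp
  also have "\<dots> \<le> real CARD('n) * b" by (intro mult_right_mono) auto
  finally have "real x \<le> real CARD('n) * b" .
  moreover have "0 \<le> queue_total y" by (simp add: sum_nonneg)
  ultimately show ?thesis
    using queue_total_service_le[OF assms(2)] by linarith
qed

lemma queue_spread_step: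
  assumes \<omega>: "\<omega> \<in> set_pmf (slot_pmf A S d v)"
  shows "\<bar>queue_spread (next_queue v \<omega>) - queue_spread v\<bar> \<le> 2 * real CARD('n) * b"
proof -
  let ?x = "\<lambda>j. real (v $ j)" and ?x' = "\<lambda>j. real (next_queue v \<omega> $ j)"
  have "\<bar>?x' j - ?x j\<bar> \<le> b" for j
    using abs_netput_le[OF \<omega>, of j] by (auto simp: next_queue_nth)
  then have "spread (\<lambda>j. ?x' j - ?x j) \<le> 2 * real CARD('n) * b" "spread (\<lambda>j. ?x j - ?x' j) \<le> 2 * real CARD('n) * b"
    by (intro spread_le_bound; simp add: abs_minus_commute)+
  with spread_add_le[of ?x "\<lambda>j. ?x' j - ?x j"] spread_add_le[of ?x' "\<lambda>j. ?x j - ?x' j"]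
  show ?thesis by simp
qed

lemma queue_spread_next_square_le:
  assumes \<omega>: "\<omega> \<in> set_pmf (slot_pmf A S d v)"
  shows "(queue_spread (next_queue v \<omega>))\<^sup>2 \<le> (queue_spread v)\<^sup>2
    + 4 * (real CARD('n) * (\<Sum>j\<in>UNIV. real (v $ j) * netput \<omega> j) - queue_total v * (\<Sum>j\<in>UNIV. netput \<omega> j))
    + (2 * real CARD('n) * b)\<^sup>2"
proof -
  have "queue_spread (next_queue v \<omega>) \<le> spread (\<lambda>j. real (v $ j) + netput \<omega> j)"
    by (rule spread_contraction) (auto simp: next_queue_nth)
  then have "(queue_spread (next_queue v \<omega>))\<^sup>2 \<le> (spread (\<lambda>j. real (v $ j) + netput \<omega> j))\<^sup>2"
    by (intro power_mono) auto
  moreover have "(spread (netput \<omega>))\<^sup>2 \<le> (2 * real CARD('n) * b)\<^sup>2"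
    by (intro power_mono spread_le_bound abs_netput_le[OF \<omega>]) auto
  ultimately show ?thesis
    unfolding spread_add_square by linarith
qed

lemma integrable_netput: "integrable (slot_pmf A S d v) (\<lambda>\<omega>. netput \<omega> j)"
  by (rule integrable_pmf_bounded[where B = b]) (simp add: abs_netput_le)

lemma expectation_netput:
  "(\<integral>\<omega>. netput \<omega> j \<partial>slot_pmf A S d v) = mean_arrivals * pmf (dest_pmf d v) j - \<mu> j"
proof -
  have b: "\<bar>netput (x, y, i) j\<bar> \<le> b" if "x \<in> set_pmf A" "y \<in> set_pmf S" "i \<in> set_pmf (dest_pmf d v)" for x y i
    by (rule abs_netput_le[of _ v]) (use that in \<open>auto simp: set_slot_pmf\<close>)
  have 1: "(\<integral>i. netput (x, y, i) j \<partial>dest_pmf d v) = real x * pmf (dest_pmf d v) j - real (y $ j)" for x y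
  proof -
    have "netput (x, y, i) j = real x * indicator {j} i - real (y $ j)" for i
      by (auto simp: netput_def arrivals_at_def)
    then show ?thesis by (simp add: measure_pmf_single integrable_pmf_bounded[where B = 1])
  qed
  have S: "integrable S (\<lambda>y. real (y $ j))"
    by (rule integrable_pmf_bounded[where B = b]) (auto simp: S_le)
  have A: "integrable A real"
    by (rule integrable_pmf_bounded[where B = b]) (auto simp: A_le)
  have "(\<integral>\<omega>. netput \<omega> j \<partial>slot_pmf A S d v) = (\<integral>x. (\<integral>z. netput (x, z) j \<partial>pair_pmf S (dest_pmf d v)) \<partial>A)"
    unfolding slot_pmf_def by (rule integral_pair_pmf_bounded[where B = b]) (auto intro: b)
  also have "\<dots> = (\<integral>x. (\<integral>y. (\<integral>i. netput (x, y, i) j \<partial>dest_pmf d v) \<partial>S) \<partial>A)"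
    by (intro integral_cong_AE AE_pmfI integral_pair_pmf_bounded[where B = b] b) auto
  also have "\<dots> = mean_arrivals * pmf (dest_pmf d v) j - \<mu> j"
    using S A by (simp add: 1)
  finally show ?thesis .
qed

text \<open>A drift of the square becomes a drift of the spread \<open>W\<close> itself through 2 W
  (W' - W) \<le> W'^2 - W^2. The square drifts by at most -2 \<delta> W plus a constant, and the
  threshold on \<open>W\<close> makes that constant at most \<delta> W; dividing by 2 W leaves
  -\<delta> / 2.\<close>

lemma expectation_spread_drift:
  assumes margin: "\<And>H. H \<noteq> {} \<Longrightarrow> H \<noteq> UNIV \<Longrightarrow>
      (\<Sum>i\<in>UNIV. \<mu> i) * (real (card H choose d) / real (CARD('n) choose d)) + \<delta> \<le> (\<Sum>i\<in>H. \<mu> i)"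
    and \<epsilon>: "0 < \<epsilon>" "\<epsilon> \<le> \<delta> / 2" and rate: "mean_arrivals = (\<Sum>i\<in>UNIV. \<mu> i) - \<epsilon>"
    and large: "(2 * real CARD('n) * b)\<^sup>2 / \<delta> < queue_spread v"
  shows "(\<integral>w. queue_spread w - queue_spread v \<partial>kernel A S d v) \<le> - (\<delta> / 2)"
proof -
  let ?J = "2 * real CARD('n) * real b" and ?W = "queue_spread v" and ?W' = "\<lambda>\<omega>. queue_spread (next_queue v \<omega>)"
  let ?E = "slot_pmf A S d v"
  have "0 \<le> ?J\<^sup>2 / \<delta>" using \<epsilon> by simp
  with large have W: "0 < ?W" by linarith
  have int: "integrable ?E (\<lambda>\<omega>. ?W' \<omega> - ?W)"
    by (rule integrable_pmf_bounded[where B = ?J]) (simp add: queue_spread_step)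
  have z: "integrable ?E (\<lambda>\<omega>. real CARD('n) * (\<Sum>j\<in>UNIV. real (v $ j) * netput \<omega> j) - queue_total v * (\<Sum>j\<in>UNIV. netput \<omega> j))"
    by (intro Bochner_Integration.integrable_diff integrable_mult_right
        Bochner_Integration.integrable_sum integrable_netput)
  have pw: "2 * ?W * (?W' \<omega> - ?W) \<le>
      4 * (real CARD('n) * (\<Sum>j\<in>UNIV. real (v $ j) * netput \<omega> j) - queue_total v * (\<Sum>j\<in>UNIV. netput \<omega> j)) + ?J\<^sup>2"
    if "\<omega> \<in> set_pmf ?E" for \<omega>
  proof -
    have "0 \<le> (?W' \<omega> - ?W)\<^sup>2" by simp
    then have "2 * ?W * (?W' \<omega> - ?W) \<le> (?W' \<omega>)\<^sup>2 - ?W\<^sup>2"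
      by (simp add: power2_eq_square algebra_simps)
    with queue_spread_next_square_le[OF that] show ?thesis by linarith
  qed
  have "2 * ?W * (\<integral>\<omega>. ?W' \<omega> - ?W \<partial>?E) = (\<integral>\<omega>. 2 * ?W * (?W' \<omega> - ?W) \<partial>?E)"
    using int by simp
  also have "\<dots> \<le> (\<integral>\<omega>. 4 * (real CARD('n) * (\<Sum>j\<in>UNIV. real (v $ j) * netput \<omega> j)
      - queue_total v * (\<Sum>j\<in>UNIV. netput \<omega> j)) + ?J\<^sup>2 \<partial>?E)"
    using int z
    by (intro integral_mono_AE AE_pmfI pw Bochner_Integration.integrable_add integrable_mult_right) auto
  also have "\<dots> = 4 * (real CARD('n) * (\<Sum>j\<in>UNIV. real (v $ j) * (\<integral>\<omega>. netput \<omega> j \<partial>?E))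
      - queue_total v * (\<Sum>j\<in>UNIV. \<integral>\<omega>. netput \<omega> j \<partial>?E)) + ?J\<^sup>2"
    using z by (simp add: integrable_netput Bochner_Integration.integral_sum)
  \<comment> \<open>The total net input has mean -\<epsilon> whatever the routing. Multiplied by the
    total queue length it supplies the second summand on the left of
    \<open>inner_drift_le\<close>.\<close>
  also have "(\<Sum>j\<in>UNIV. \<integral>\<omega>. netput \<omega> j \<partial>?E) = - \<epsilon>"
    by (simp add: expectation_netput sum_subtractf sum_pmf_eq_1 rate flip: sum_distrib_left)
  also have "4 * (real CARD('n) * (\<Sum>j\<in>UNIV. real (v $ j) * (\<integral>\<omega>. netput \<omega> j \<partial>?E)) - queue_total v * (- \<epsilon>)) + ?J\<^sup>2
      \<le> 4 * (- (\<delta> / 2) * ?W) + ?J\<^sup>2"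
    using inner_drift_le[of d "\<chi> i. \<mu> i" \<delta> \<epsilon> v] d_pos d_le margin \<epsilon>
    by (simp add: expectation_netput rate mult.commute)
  finally have "2 * ?W * (\<integral>\<omega>. ?W' \<omega> - ?W \<partial>?E) \<le> - 2 * \<delta> * ?W + ?J\<^sup>2" by simp
  also have "?J\<^sup>2 \<le> \<delta> * ?W"
    using large \<epsilon> by (simp add: field_simps)
  finally have "?W * (2 * (\<integral>\<omega>. ?W' \<omega> - ?W \<partial>?E) + \<delta>) \<le> 0"
    by (simp add: algebra_simps)
  then have "(\<integral>\<omega>. ?W' \<omega> - ?W \<partial>?E) \<le> - (\<delta> / 2)"
    using W by (simp add: mult_le_0_iff)
  then show ?thesis by (simp add: kernel_def)
qed

end

text \<open>The order of quantifiers is the point: \<open>C\<close> is fixed by \<open>S\<close>,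
  \<open>d\<close>, \<open>b\<close> and \<delta> before the arrival law, \<epsilon> and the
  stationary law are chosen.\<close>

lemma state_space_collapse:
  fixes S :: "(nat ^ 'n::finite) pmf"
  assumes \<delta>: "0 < \<delta>"
    and margin: "\<And>H. H \<noteq> {} \<Longrightarrow> H \<noteq> UNIV \<Longrightarrow>
      (\<Sum>i\<in>UNIV. \<integral>y. real (y $ i) \<partial>S) * (real (card H choose d) / real (CARD('n) choose d)) + \<delta>
        \<le> (\<Sum>i\<in>H. \<integral>y. real (y $ i) \<partial>S)"
  obtains C where "0 \<le> C"
    "\<And>A \<epsilon> \<pi>. load_balancer A S d b \<Longrightarrow> 0 < \<epsilon> \<Longrightarrow> \<epsilon> \<le> \<delta> / 2 \<Longrightarrow>
      (\<integral>x. real x \<partial>A) = (\<Sum>i\<in>UNIV. \<integral>y. real (y $ i) \<partial>S) - \<epsilon> \<Longrightarrow> \<pi> = bind_pmf \<pi> (kernel A S d) \<Longrightarrow>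
      integrable \<pi> (\<lambda>v. (queue_spread v)\<^sup>2) \<and> (\<integral>v. (queue_spread v)\<^sup>2 \<partial>\<pi>) \<le> C"
proof -
  \<comment> \<open>The summand 1 keeps the jump bound positive when \<open>b = 0\<close>. The
    threshold below also gets a summand 1, because \<open>expectation_spread_drift\<close> asks for
    a strict inequality.\<close>
  let ?J = "2 * real CARD('n) * real b + 1"
  have J: "0 < ?J" "0 < \<delta> / 2" using \<delta> by (auto intro: add_nonneg_pos)
  obtain C where C: "0 \<le> C"
    "\<And>(\<pi> :: (nat ^ 'n) pmf) K W. \<pi> = bind_pmf \<pi> K \<Longrightarrow> (\<And>v. 0 \<le> W v) \<Longrightarrow>
      (\<And>v w. w \<in> set_pmf (K v) \<Longrightarrow> \<bar>W w - W v\<bar> \<le> ?J) \<Longrightarrow>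
      (\<And>v. (2 * real CARD('n) * real b)\<^sup>2 / \<delta> + 1 \<le> W v \<Longrightarrow> (\<integral>w. W w - W v \<partial>K v) \<le> - (\<delta> / 2)) \<Longrightarrow>
      integrable \<pi> (\<lambda>v. (W v)\<^sup>2) \<and> (\<integral>v. (W v)\<^sup>2 \<partial>\<pi>) \<le> C"
    by (rule stationary_second_moment_bound[OF J]) blast
  show thesis
  proof (rule that[OF C(1)])
    fix A \<epsilon> \<pi>
    assume "load_balancer A S d b" and \<epsilon>: "0 < \<epsilon>" "\<epsilon> \<le> \<delta> / 2"
      and rate: "(\<integral>x. real x \<partial>A) = (\<Sum>i\<in>UNIV. \<integral>y. real (y $ i) \<partial>S) - \<epsilon>"
      and stat: "\<pi> = bind_pmf \<pi> (kernel A S d)"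
    interpret load_balancer A S d b by fact
    show "integrable \<pi> (\<lambda>v. (queue_spread v)\<^sup>2) \<and> (\<integral>v. (queue_spread v)\<^sup>2 \<partial>\<pi>) \<le> C"
    proof (rule C(2)[OF stat])
      show "\<bar>queue_spread w - queue_spread v\<bar> \<le> ?J" if "w \<in> set_pmf (kernel A S d v)" for v w
        using that queue_spread_step by (force simp: kernel_def)
      show "(\<integral>w. queue_spread w - queue_spread v \<partial>kernel A S d v) \<le> - (\<delta> / 2)"
        if "(2 * real CARD('n) * real b)\<^sup>2 / \<delta> + 1 \<le> queue_spread v" for v
        using expectation_spread_drift[OF margin \<epsilon> rate, of v] that by simp
    qed simp
  qed
qed

subsection \<open>The transform argument\<close>

lemma norm_iexp_minus_1_le: "norm (iexp x - 1) \<le> \<bar>x\<bar>"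
  using iexp_approx1[of x 0] by simp

lemma norm_iexp_linear_le: "norm (iexp x - 1 - \<i> * x) \<le> x\<^sup>2 / 2"
  using iexp_approx1[of x 1] by (simp add: power2_eq_square algebra_simps)

lemma norm_iexp_quadratic_le: "norm (iexp x - 1 - \<i> * x + x\<^sup>2 / 2) \<le> \<bar>x\<bar> ^ 3 / 6"
  using iexp_approx1[of x 2]
  by (simp add: eval_nat_numeral power2_eq_square algebra_simps)

context load_balancer
begin

definition joint :: "(nat ^ 'n) pmf \<Rightarrow> ((nat ^ 'n) \<times> (nat \<times> (nat ^ 'n) \<times> 'n)) pmf" where
  "joint \<pi> = bind_pmf \<pi> (\<lambda>v. map_pmf (Pair v) (slot_pmf A S d v))"

lemma set_joint: "(v, \<omega>) \<in> set_pmf (joint \<pi>) \<longleftrightarrow> v \<in> set_pmf \<pi> \<and> \<omega> \<in> set_pmf (slot_pmf A S d v)"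
  by (auto simp: joint_def)

lemma map_joint_current: "map_pmf fst (joint \<pi>) = \<pi>"
  by (simp add: joint_def map_bind_pmf map_pmf_comp bind_return_pmf')

lemma map_joint_next: "map_pmf (\<lambda>(v, \<omega>). next_queue v \<omega>) (joint \<pi>) = bind_pmf \<pi> (kernel A S d)"
  by (simp add: joint_def map_bind_pmf map_pmf_comp kernel_def[abs_def])

text \<open>The destination depends on \<open>v\<close>, so independence of state and input appears
  only once the destination is forgotten. This later factorizes the transform.\<close>

lemma map_joint_input: "map_pmf (\<lambda>(v, x, y, i). (v, x, y)) (joint \<pi>) = pair_pmf \<pi> (pair_pmf A S)"
proof -
  have "map_pmf (\<lambda>(x, y, i). (v, x, y)) (slot_pmf A S d v) = map_pmf (Pair v) (pair_pmf A S)" for v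
    by (simp add: slot_pmf_def pair_pmf_conv_bind_map map_bind_pmf map_pmf_comp)
      (simp add: map_pmf_def)
  then show ?thesis
    by (simp add: joint_def pair_pmf_conv_bind_map[of \<pi>] map_bind_pmf map_pmf_comp)
qed

abbreviation "net_total \<equiv> \<lambda>(x, y). real x - queue_total (y :: nat ^ 'n)"

definition net_second_moment :: real where
  "net_second_moment = (\<integral>z. (net_total z)\<^sup>2 \<partial>pair_pmf A S)"

lemma integrable_net_total:
  "integrable (pair_pmf A S) net_total" "integrable (pair_pmf A S) (\<lambda>z. (net_total z)\<^sup>2)"
proof -
  have *: "\<bar>net_total z\<bar> \<le> real CARD('n) * b" if "z \<in> set_pmf (pair_pmf A S)" for z
    using that abs_net_total_le by auto
  show "integrable (pair_pmf A S) net_total"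
    by (rule integrable_pmf_bounded[where B = "real CARD('n) * b"]) (use * in auto)
  show "integrable (pair_pmf A S) (\<lambda>z. (net_total z)\<^sup>2)"
  proof (rule integrable_pmf_bounded)
    show "norm ((net_total z)\<^sup>2) \<le> (real CARD('n) * b)\<^sup>2" if "z \<in> set_pmf (pair_pmf A S)" for z
      using power_mono[OF *[OF that], of 2] by simp
  qed
qed

lemma expectation_net_total:
  "(\<integral>z. net_total z \<partial>pair_pmf A S) = mean_arrivals - (\<Sum>i\<in>UNIV. \<mu> i)"
proof -
  have S: "integrable S (\<lambda>y. real (y $ j))" for j
    by (rule integrable_pmf_bounded[where B = b]) (auto simp: S_le)
  have A: "integrable A real"
    by (rule integrable_pmf_bounded[where B = b]) (auto simp: A_le)
  have "(\<integral>z. net_total z \<partial>pair_pmf A S) = (\<integral>x. (\<integral>y. real x - queue_total y \<partial>S) \<partial>A)"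
    by (subst integral_pair_pmf_bounded[where B = "real CARD('n) * b"]) (auto intro: abs_net_total_le)
  also have "\<dots> = mean_arrivals - (\<Sum>i\<in>UNIV. \<mu> i)"
    using S A by (simp add: Bochner_Integration.integral_sum)
  finally show ?thesis .
qed

end

section \<open>Balance identities of one stationary slot\<close>

locale stationary_load_balancer = load_balancer A S d b
  for A and S :: "(nat ^ 'n::finite) pmf" and d b +
  fixes \<pi> :: "(nat ^ 'n) pmf" and \<epsilon> C :: real
  assumes stationary: "\<pi> = bind_pmf \<pi> (kernel A S d)"
    and \<epsilon>: "0 < \<epsilon>"
    and rate: "mean_arrivals = (\<Sum>i\<in>UNIV. \<mu> i) - \<epsilon>"
    and collapse: "integrable \<pi> (\<lambda>v. (queue_spread v)\<^sup>2)" "(\<integral>v. (queue_spread v)\<^sup>2 \<partial>\<pi>) \<le> C"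
begin

abbreviation "J \<equiv> joint \<pi>"

abbreviation "U \<equiv> \<lambda>(v :: nat ^ 'n, \<omega>). real (unused_total v \<omega>)"

abbreviation "Q' \<equiv> \<lambda>(v :: nat ^ 'n, \<omega>). queue_total (next_queue v \<omega>)"

abbreviation "X \<equiv> \<lambda>(v :: nat ^ 'n, x :: nat, y :: nat ^ 'n, i :: 'n). real x - queue_total y"

lemma expectation_current:
  fixes f :: "nat ^ 'n \<Rightarrow> 'b::{banach, second_countable_topology}"
  shows "(\<integral>z. f (fst z) \<partial>J) = (\<integral>v. f v \<partial>\<pi>)"
proof -
  have "(\<integral>v. f v \<partial>map_pmf fst J) = (\<integral>v. f v \<partial>\<pi>)"
    by (simp only: map_joint_current)
  then show ?thesis by simp
qed

lemma expectation_next: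
  fixes f :: "nat ^ 'n \<Rightarrow> 'b::{banach, second_countable_topology}"
  shows "(\<integral>z. f (case z of (v, \<omega>) \<Rightarrow> next_queue v \<omega>) \<partial>J) = (\<integral>v. f v \<partial>\<pi>)"
proof -
  have "\<pi> = map_pmf (\<lambda>(v, \<omega>). next_queue v \<omega>) J"
    using stationary by (simp add: map_joint_next)
  then have "(\<integral>v. f v \<partial>\<pi>) = (\<integral>v. f v \<partial>map_pmf (\<lambda>(v, \<omega>). next_queue v \<omega>) J)"
    by (rule arg_cong)
  then show ?thesis by simp
qed

lemma expectation_input:
  fixes f :: "nat \<times> (nat ^ 'n) \<Rightarrow> 'b::{banach, second_countable_topology}"
  shows "(\<integral>z. f (case z of (v, x, y, i) \<Rightarrow> (x, y)) \<partial>J) = (\<integral>z. f z \<partial>pair_pmf A S)"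
proof -
  have "pair_pmf A S = map_pmf snd (map_pmf (\<lambda>(v, x, y, i). (v, x, y)) J)"
    by (simp add: map_joint_input map_snd_pair_pmf)
  also have "\<dots> = map_pmf (\<lambda>(v, x, y, i). (x, y)) J"
    unfolding map_pmf_comp by (simp add: case_prod_unfold)
  finally have "(\<integral>z. f z \<partial>pair_pmf A S) = (\<integral>z. f z \<partial>map_pmf (\<lambda>(v, x, y, i). (x, y)) J)"
    by (rule arg_cong)
  then show ?thesis by simp
qed

lemma Q'_eq: "Q' z = queue_total (fst z) + X z + U z"
  using queue_total_next by (cases z) auto

lemma U_bounds: "z \<in> set_pmf J \<Longrightarrow> U z \<le> real CARD('n) * b"
  and X_bounds: "z \<in> set_pmf J \<Longrightarrow> \<bar>X z\<bar> \<le> real CARD('n) * b"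
  using unused_total_le abs_net_total_le by (cases z; auto simp: set_joint set_slot_pmf)+

lemma U_nonneg: "0 \<le> U z"
  by (cases z) auto

lemma integrable_U: "integrable J U"
  by (rule integrable_pmf_bounded[where B = "real CARD('n) * b"]) (use U_bounds U_nonneg in fastforce)

lemma integrable_X: "integrable J X"
  by (rule integrable_pmf_bounded[where B = "real CARD('n) * b"]) (use X_bounds in fastforce)

lemma integrable_U_square: "integrable J (\<lambda>z. (U z)\<^sup>2)"
  by (rule integrable_pmf_bounded[where B = "(real CARD('n) * b)\<^sup>2"])
    (use U_bounds U_nonneg in \<open>force intro!: power_mono\<close>)

text \<open>The mean total queue length may a priori be infinite, hence the truncation at \<open>L\<close>.\<close>

lemma expectation_U: "(\<integral>z. U z \<partial>J) = \<epsilon>"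
proof -
  let ?B = "2 * (real CARD('n) * b)"
  define D where "D L z = min (Q' z) (real L) - min (queue_total (fst z)) (real L)" for L z
  have int: "integrable J (\<lambda>z. min (Q' z) (real L))" "integrable J (\<lambda>z. min (queue_total (fst z)) (real L))" for L
    by (rule integrable_pmf_bounded[where B = "real L"]; auto simp: sum_nonneg)+
  have "(\<integral>z. D L z \<partial>J) = (\<integral>z. min (Q' z) (real L) \<partial>J) - (\<integral>z. min (queue_total (fst z)) (real L) \<partial>J)" for L
    unfolding D_def by (rule Bochner_Integration.integral_diff[OF int])
  also have "\<dots> L = 0" for L
    using expectation_next[of "\<lambda>v. min (queue_total v) (real L)"]
      expectation_current[of "\<lambda>v. min (queue_total v) (real L)"] by (simp add: case_prod_unfold)
  finally have D0: "(\<integral>z. D L z \<partial>J) = 0" for L .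
  \<comment> \<open>Truncation is 1-Lipschitz, so \<open>D L\<close> is dominated by the bounded
    increment \<open>X + U\<close>, even where \<open>Q'\<close> itself might fail to be
    integrable.\<close>
  have "(\<lambda>L. \<integral>z. D L z \<partial>J) \<longlonglongrightarrow> (\<integral>z. X z + U z \<partial>J)"
  proof (rule integral_dominated_convergence[where w = "\<lambda>_. ?B"])
    show "AE z in J. (\<lambda>L. D L z) \<longlonglongrightarrow> X z + U z"
    proof (rule AE_I2, rule tendsto_eventually)
      fix z
      obtain k where k: "max (Q' z) (queue_total (fst z)) \<le> real k" using real_arch_simple by blast
      show "\<forall>\<^sub>F L in sequentially. D L z = X z + U z"
        using eventually_ge_at_top[of k]
      proof eventually_elim
        case (elim L)
        then have "max (Q' z) (queue_total (fst z)) \<le> real L" using k by linarith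
        then show ?case using Q'_eq[of z] by (simp add: D_def)
      qed
    qed
    show "AE z in J. norm (D L z) \<le> ?B" for L
    proof (rule AE_pmfI)
      fix z assume z: "z \<in> set_pmf J"
      have "norm (D L z) \<le> \<bar>X z + U z\<bar>"
        using Q'_eq[of z] by (auto simp: D_def)
      also have "\<dots> \<le> ?B"
        using X_bounds[OF z] U_bounds[OF z] U_nonneg[of z] by (simp add: abs_le_iff)
      finally show "norm (D L z) \<le> ?B" .
    qed
  qed auto
  then have "(\<integral>z. X z + U z \<partial>J) = 0"
    unfolding D0 using LIMSEQ_unique tendsto_const by blast
  then have "(\<integral>z. U z \<partial>J) = - (\<integral>z. X z \<partial>J)"
    using integrable_X integrable_U by simp
  also have "(\<integral>z. X z \<partial>J) = (\<integral>z. net_total z \<partial>pair_pmf A S)"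
    unfolding expectation_input[symmetric] by (intro Bochner_Integration.integral_cong) auto
  also have "\<dots> = - \<epsilon>"
    by (simp add: expectation_net_total rate)
  finally show ?thesis by simp
qed

text \<open>A bounded nonnegative variable with mean \<epsilon> has a second moment of order
  \<epsilon>.\<close>

lemma expectation_U_square: "(\<integral>z. (U z)\<^sup>2 \<partial>J) \<le> real CARD('n) * b * \<epsilon>"
proof -
  have "(\<integral>z. (U z)\<^sup>2 \<partial>J) \<le> (\<integral>z. real CARD('n) * b * U z \<partial>J)"
    using integrable_U integrable_U_square U_bounds U_nonneg
    by (intro integral_mono_AE AE_pmfI) (auto simp: power2_eq_square intro!: mult_right_mono)
  then show ?thesis by (simp add: expectation_U)
qed

text \<open>Where service is wasted, \<open>Q'\<close> is at most \<open>n\<close> times the spread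
  \<open>?W\<close>. The product of \<open>?W\<close> and \<open>U\<close> is then split by the
  inequality of arithmetic and geometric means with weight \<open>sqrt \<epsilon>\<close>: this
  balances the second moment of \<open>?W\<close>, which is of order 1, against that of
  \<open>U\<close>, which is of order \<epsilon>.\<close>

lemma expectation_total_times_unused:
  "integrable J (\<lambda>z. Q' z * U z)"
  "(\<integral>z. Q' z * U z \<partial>J) \<le> real CARD('n) * sqrt \<epsilon> * (C + real CARD('n) * b) / 2"
proof -
  let ?n = "real CARD('n)"
  let ?W = "\<lambda>z. queue_spread (case z of (v, \<omega>) \<Rightarrow> next_queue v \<omega>)"
  have intW: "integrable J (\<lambda>z. (?W z)\<^sup>2)"
  proof -
    have "integrable (map_pmf (\<lambda>(v, \<omega>). next_queue v \<omega>) J) (\<lambda>v. (queue_spread v)\<^sup>2)"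
      using collapse(1) stationary by (simp add: map_joint_next)
    then show ?thesis by simp
  qed
  have \<kappa>: "0 < sqrt \<epsilon>" using \<epsilon> by simp
  have pw: "0 \<le> Q' z * U z" "Q' z * U z \<le> ?n * (sqrt \<epsilon> * (?W z)\<^sup>2 + (U z)\<^sup>2 / sqrt \<epsilon>) / 2" for z
  proof -
    show "0 \<le> Q' z * U z" by (cases z) (auto simp: sum_nonneg)
    have amgm: "?W z * U z \<le> (sqrt \<epsilon> * (?W z)\<^sup>2 + (U z)\<^sup>2 / sqrt \<epsilon>) / 2"
    proof -
      have "0 \<le> (sqrt \<epsilon> * ?W z - U z)\<^sup>2" by simp
      then have "2 * (sqrt \<epsilon> * (?W z * U z)) \<le> sqrt \<epsilon> * (sqrt \<epsilon> * (?W z)\<^sup>2) + (U z)\<^sup>2"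
        by (simp add: power2_eq_square algebra_simps)
      then show ?thesis using \<kappa> by (simp add: field_simps)
    qed
    have "Q' z * U z \<le> ?n * (?W z * U z)"
    proof (cases "U z = 0")
      case False
      then have "Q' z \<le> ?n * ?W z"
        using queue_total_le_spread_if_unused by (cases z) auto
      then show ?thesis using U_nonneg[of z] by (simp add: mult_right_mono flip: mult.assoc)
    qed simp
    also have "\<dots> \<le> ?n * ((sqrt \<epsilon> * (?W z)\<^sup>2 + (U z)\<^sup>2 / sqrt \<epsilon>) / 2)"
      by (intro mult_left_mono amgm) auto
    finally show "Q' z * U z \<le> ?n * (sqrt \<epsilon> * (?W z)\<^sup>2 + (U z)\<^sup>2 / sqrt \<epsilon>) / 2" by simp
  qed
  have int: "integrable J (\<lambda>z. ?n * (sqrt \<epsilon> * (?W z)\<^sup>2 + (U z)\<^sup>2 / sqrt \<epsilon>) / 2)"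
    using intW integrable_U_square by simp
  show int': "integrable J (\<lambda>z. Q' z * U z)"
  proof (rule Bochner_Integration.integrable_bound[OF int])
    show "AE z in J. norm (Q' z * U z) \<le> norm (?n * (sqrt \<epsilon> * (?W z)\<^sup>2 + (U z)\<^sup>2 / sqrt \<epsilon>) / 2)"
      using pw order.trans[OF pw(1) pw(2)] by (intro AE_I2) (simp only: real_norm_def abs_of_nonneg)
  qed simp
  have "(\<integral>z. Q' z * U z \<partial>J) \<le> (\<integral>z. ?n * (sqrt \<epsilon> * (?W z)\<^sup>2 + (U z)\<^sup>2 / sqrt \<epsilon>) / 2 \<partial>J)"
    by (intro integral_mono int int' pw)
  also have "\<dots> = ?n * (sqrt \<epsilon> * (\<integral>v. (queue_spread v)\<^sup>2 \<partial>\<pi>) + (\<integral>z. (U z)\<^sup>2 \<partial>J) / sqrt \<epsilon>) / 2"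
    using intW integrable_U_square expectation_next[of "\<lambda>v. (queue_spread v)\<^sup>2"] by simp
  also have "\<dots> \<le> ?n * (sqrt \<epsilon> * C + (?n * b * \<epsilon>) / sqrt \<epsilon>) / 2"
    using \<kappa> collapse(2) expectation_U_square
    by (intro divide_right_mono mult_left_mono add_mono) auto
  also have "(?n * b * \<epsilon>) / sqrt \<epsilon> = ?n * b * sqrt \<epsilon>"
    using \<epsilon> by (simp add: field_simps)
  finally show "(\<integral>z. Q' z * U z \<partial>J) \<le> ?n * sqrt \<epsilon> * (C + ?n * b) / 2"
    by (simp add: algebra_simps)
qed

text \<open>Expand \<open>exp (i \<tau> (Q' - U)) = exp (i \<tau> (Q + X))\<close> around \<open>U = 0\<close> and
  \<open>Q' = 0\<close>.\<close>

lemma transform_equation: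
  fixes \<tau> :: real
  defines "\<phi> \<equiv> (\<integral>v. iexp (\<tau> * queue_total v) \<partial>\<pi>)"
  shows "norm (\<phi> * ((\<integral>z. iexp (\<tau> * net_total z) \<partial>pair_pmf A S) - 1) - ((\<integral>z. iexp (- \<tau> * U z) \<partial>J) - 1))
    \<le> \<tau>\<^sup>2 * (real CARD('n) * sqrt \<epsilon> * (C + real CARD('n) * b) / 2)"
proof -
  let ?f = "\<lambda>z. (iexp (\<tau> * Q' z) - 1) * (iexp (- \<tau> * U z) - 1)"
  have int: "integrable J (\<lambda>z. iexp (g z))" for g
    by (rule integrable_pmf_bounded[where B = 1]) simp
  have int2: "integrable J (\<lambda>z. iexp (g z) * iexp (h z))" for g h
    by (rule integrable_pmf_bounded[where B = 1]) (simp add: norm_mult)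
  have f_eq: "?f z = iexp (\<tau> * queue_total (fst z)) * iexp (\<tau> * X z) - iexp (\<tau> * Q' z) - iexp (- \<tau> * U z) + 1" for z
  proof -
    have "iexp (\<tau> * queue_total (fst z)) * iexp (\<tau> * X z) = iexp (\<tau> * Q' z) * iexp (- \<tau> * U z)"
      unfolding Q'_eq exp_add[symmetric] by (rule arg_cong[of _ _ exp]) (simp add: algebra_simps)
    then show ?thesis by (simp add: algebra_simps)
  qed
  have "(\<integral>z. ?f z \<partial>J) = (\<integral>z. iexp (\<tau> * queue_total (fst z)) * iexp (\<tau> * X z) \<partial>J)
      - (\<integral>z. iexp (\<tau> * Q' z) \<partial>J) - (\<integral>z. iexp (- \<tau> * U z) \<partial>J) + 1"
  proof -
    have "(\<integral>z. F z - G z - H z + 1 \<partial>J) = (\<integral>z. F z \<partial>J) - (\<integral>z. G z \<partial>J) - (\<integral>z. H z \<partial>J) + 1"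
      if "integrable J F" "integrable J G" "integrable J H" for F G H :: "_ \<Rightarrow> complex"
      using that by simp
    from this[OF int2 int int] show ?thesis unfolding f_eq .
  qed
  also have "(\<integral>z. iexp (\<tau> * Q' z) \<partial>J) = \<phi>"
    using expectation_next[of "\<lambda>v. iexp (\<tau> * queue_total v)"] by (simp add: \<phi>_def case_prod_unfold)
  \<comment> \<open>The current queue lengths are independent of the net input, so the transform of
    the sum splits.\<close>
  also have "(\<integral>z. iexp (\<tau> * queue_total (fst z)) * iexp (\<tau> * X z) \<partial>J)
      = \<phi> * (\<integral>z. iexp (\<tau> * net_total z) \<partial>pair_pmf A S)"
  proof -
    have "(\<integral>z. iexp (\<tau> * queue_total (fst z)) * iexp (\<tau> * X z) \<partial>J)
        = (\<integral>z. iexp (\<tau> * queue_total (fst z)) * iexp (\<tau> * net_total (snd z)) \<partial>map_pmf (\<lambda>(v, x, y, i). (v, x, y)) J)"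
      unfolding integral_map_pmf by (intro Bochner_Integration.integral_cong) auto
    also have "\<dots> = (\<integral>v. (\<integral>z. iexp (\<tau> * queue_total v) * iexp (\<tau> * net_total z) \<partial>pair_pmf A S) \<partial>\<pi>)"
      unfolding map_joint_input pair_pmf_conv_bind_map[of \<pi>]
      by (subst integral_bind_pmf_bounded_complex[where B = 1]) (auto simp: norm_mult)
    finally show ?thesis by (simp add: \<phi>_def)
  qed
  finally have eq: "\<phi> * ((\<integral>z. iexp (\<tau> * net_total z) \<partial>pair_pmf A S) - 1) - ((\<integral>z. iexp (- \<tau> * U z) \<partial>J) - 1)
      = (\<integral>z. ?f z \<partial>J)"
    by (simp add: algebra_simps)
  have "norm (?f z) \<le> \<tau>\<^sup>2 * (Q' z * U z)" for z
  proof -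
    \<comment> \<open>A linear bound on each factor suffices, because the product
      \<open>Q' * U\<close> already has a small mean.\<close>
    have "norm (?f z) \<le> \<bar>\<tau> * Q' z\<bar> * \<bar>- \<tau> * U z\<bar>"
      unfolding norm_mult by (intro mult_mono norm_iexp_minus_1_le) auto
    also have "\<dots> = \<tau>\<^sup>2 * (Q' z * U z)"
    proof -
      have "\<bar>\<tau> * p\<bar> * \<bar>- \<tau> * u\<bar> = \<tau>\<^sup>2 * (p * u)" if "0 \<le> p" "0 \<le> u" for p u
        using that by (subst power2_abs[symmetric]) (simp add: abs_mult power2_eq_square mult_ac)
      moreover have "0 \<le> Q' z" by (cases z) (simp add: sum_nonneg)
      ultimately show ?thesis using U_nonneg[of z] by blast
    qed
    finally show ?thesis .
  qed
  note pw = this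
  have "norm (\<integral>z. ?f z \<partial>J) \<le> (\<integral>z. \<tau>\<^sup>2 * (Q' z * U z) \<partial>J)"
  proof (rule order.trans[OF integral_norm_bound], rule integral_mono_AE')
    show "integrable J (\<lambda>z. \<tau>\<^sup>2 * (Q' z * U z))"
      using expectation_total_times_unused(1) by simp
    show "AE z in J. norm (?f z) \<le> \<tau>\<^sup>2 * (Q' z * U z)"
      by (intro AE_I2 pw)
    show "AE z in J. 0 \<le> \<tau>\<^sup>2 * (Q' z * U z)"
      by (intro AE_I2 order.trans[OF norm_ge_zero pw])
  qed
  also have "\<dots> \<le> \<tau>\<^sup>2 * (real CARD('n) * sqrt \<epsilon> * (C + real CARD('n) * b) / 2)"
    unfolding integral_mult_right_zero by (intro mult_left_mono expectation_total_times_unused(2)) simp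
  finally show ?thesis unfolding eq .
qed

text \<open>The net input is expanded to second order, since its mean is only -\<epsilon> and its
  second moment counts equally when \<tau> is of order \<epsilon>. For \<open>U\<close> the first
  order is enough: its second moment is of order \<epsilon>, so the remainder is of order
  \<epsilon>^3.\<close>

lemma transform_estimate:
  fixes \<tau> :: real
  defines "\<phi> \<equiv> (\<integral>v. iexp (\<tau> * queue_total v) \<partial>\<pi>)"
  shows "norm (\<phi> * (\<i> * \<tau> * \<epsilon> + \<tau>\<^sup>2 * net_second_moment / 2) - \<i> * \<tau> * \<epsilon>)
    \<le> \<bar>\<tau>\<bar> ^ 3 * (real CARD('n) * b) ^ 3 / 6 + \<tau>\<^sup>2 * (real CARD('n) * b * \<epsilon>) / 2
      + \<tau>\<^sup>2 * (real CARD('n) * sqrt \<epsilon> * (C + real CARD('n) * b) / 2)"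
proof -
  let ?P = "pair_pmf A S" and ?n = "real CARD('n)"
  define G where "G = (\<integral>z. iexp (\<tau> * net_total z) \<partial>?P)"
  define H where "H = (\<integral>z. iexp (- \<tau> * U z) \<partial>J)"
  have intP: "integrable ?P (\<lambda>z. iexp (g z))" for g
    by (rule integrable_pmf_bounded[where B = 1]) simp
  have intJ: "integrable J (\<lambda>z. iexp (g z))" for g
    by (rule integrable_pmf_bounded[where B = 1]) simp
  have \<phi>1: "norm \<phi> \<le> 1"
    unfolding \<phi>_def by (rule norm_integral_pmf_le) simp
  have "G - 1 + \<i> * \<tau> * \<epsilon> + \<tau>\<^sup>2 * net_second_moment / 2
     = (\<integral>z. iexp (\<tau> * net_total z) - 1 - \<i> * (\<tau> * net_total z) + (\<tau> * net_total z)\<^sup>2 / 2 \<partial>?P)"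
    (is "_ = integral\<^sup>L _ ?g")
  proof -
    have "(\<integral>z. complex_of_real (net_total z) \<partial>?P) = complex_of_real (- \<epsilon>)"
      by (subst integral_complex_of_real, subst expectation_net_total, simp add: rate)
    moreover have "(\<integral>z. complex_of_real ((net_total z)\<^sup>2) \<partial>?P) = complex_of_real net_second_moment"
      by (subst integral_complex_of_real) (simp add: net_second_moment_def)
    moreover have "integrable ?P (\<lambda>z. complex_of_real (net_total z))"
      "integrable ?P (\<lambda>z. complex_of_real ((net_total z)\<^sup>2))"
      using integrable_net_total by (intro integrable_of_real; simp)+
    moreover have "?g = (\<lambda>z. iexp (\<tau> * net_total z) - 1 - \<i> * \<tau> * complex_of_real (net_total z)
        + \<tau>\<^sup>2 / 2 * complex_of_real ((net_total z)\<^sup>2))"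
      by (simp add: fun_eq_iff power_mult_distrib)
    ultimately show ?thesis
      using intP[of "\<lambda>z. \<tau> * net_total z"] by (simp add: G_def)
  qed
  also have "norm \<dots> \<le> \<bar>\<tau>\<bar> ^ 3 * (?n * b) ^ 3 / 6"
  proof (rule norm_integral_pmf_le)
    fix z assume z: "z \<in> set_pmf ?P"
    then have "\<bar>net_total z\<bar> ^ 3 \<le> (?n * b) ^ 3"
      by (intro power_mono) (auto intro: abs_net_total_le)
    then have "\<bar>\<tau> * net_total z\<bar> ^ 3 / 6 \<le> \<bar>\<tau>\<bar> ^ 3 * (?n * b) ^ 3 / 6"
      unfolding abs_mult power_mult_distrib by (intro divide_right_mono mult_left_mono) auto
    with norm_iexp_quadratic_le[of "\<tau> * net_total z"]
    show "norm (?g z) \<le> \<bar>\<tau>\<bar> ^ 3 * (?n * b) ^ 3 / 6"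
      by simp
  qed
  finally have G: "norm (G - 1 + \<i> * \<tau> * \<epsilon> + \<tau>\<^sup>2 * net_second_moment / 2) \<le> \<bar>\<tau>\<bar> ^ 3 * (?n * b) ^ 3 / 6" .
  have "H - 1 + \<i> * \<tau> * \<epsilon> = (\<integral>z. iexp (- \<tau> * U z) - 1 - \<i> * (- \<tau> * U z) \<partial>J)"
    (is "_ = integral\<^sup>L _ ?h")
  proof -
    have "(\<integral>z. complex_of_real (U z) \<partial>J) = complex_of_real \<epsilon>"
      by (subst integral_complex_of_real, subst expectation_U, simp)
    moreover have "integrable J (\<lambda>z. complex_of_real (U z))"
      using integrable_U by (intro integrable_of_real)
    moreover have "?h = (\<lambda>z. iexp (- \<tau> * U z) - 1 + \<i> * \<tau> * complex_of_real (U z))"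
      by (simp add: fun_eq_iff)
    ultimately show ?thesis
      using intJ[of "\<lambda>z. - \<tau> * U z"] by (simp add: H_def)
  qed
  also have "norm \<dots> \<le> (\<integral>z. \<tau>\<^sup>2 / 2 * (U z)\<^sup>2 \<partial>J)"
  proof (rule order.trans[OF integral_norm_bound], rule integral_mono_AE')
    show "integrable J (\<lambda>z. \<tau>\<^sup>2 / 2 * (U z)\<^sup>2)"
      using integrable_U_square by simp
    show "AE z in J. norm (?h z) \<le> \<tau>\<^sup>2 / 2 * (U z)\<^sup>2"
      using norm_iexp_linear_le[of "- \<tau> * U z" for z] by (intro AE_I2) (simp add: power_mult_distrib)
  qed simp
  also have "\<dots> \<le> \<tau>\<^sup>2 * (?n * b * \<epsilon>) / 2"
    using mult_left_mono[OF expectation_U_square, of "\<tau>\<^sup>2 / 2"] by simp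
  finally have H: "norm (H - 1 + \<i> * \<tau> * \<epsilon>) \<le> \<tau>\<^sup>2 * (?n * b * \<epsilon>) / 2" .
  have "\<phi> * (\<i> * \<tau> * \<epsilon> + \<tau>\<^sup>2 * net_second_moment / 2) - \<i> * \<tau> * \<epsilon> =
      \<phi> * (G - 1 + \<i> * \<tau> * \<epsilon> + \<tau>\<^sup>2 * net_second_moment / 2) - (H - 1 + \<i> * \<tau> * \<epsilon>)
      - (\<phi> * (G - 1) - (H - 1))"
    by (simp add: algebra_simps)
  also have "norm \<dots> \<le> norm (\<phi> * (G - 1 + \<i> * \<tau> * \<epsilon> + \<tau>\<^sup>2 * net_second_moment / 2))
      + norm (H - 1 + \<i> * \<tau> * \<epsilon>) + norm (\<phi> * (G - 1) - (H - 1))"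
    by (meson norm_triangle_ineq4 order.trans add_right_mono)
  also have "norm (\<phi> * (G - 1 + \<i> * \<tau> * \<epsilon> + \<tau>\<^sup>2 * net_second_moment / 2)) \<le> 1 * (\<bar>\<tau>\<bar> ^ 3 * (?n * b) ^ 3 / 6)"
    unfolding norm_mult by (intro mult_mono \<phi>1 G) auto
  also note H
  also note transform_equation[of \<tau>, folded \<phi>_def G_def H_def]
  finally show ?thesis by simp
qed

end

subsection \<open>Capacity region\<close>

lemma sum_take_sorted_le_submultiset:
  fixes xs :: "real list"
  assumes "sorted xs" "N \<subseteq># mset xs"
  shows "sum_list (take (size N) xs) \<le> sum_mset N"
  using assms
proof (induction xs arbitrary: N)
  case Nil
  then show ?case by simp
next
  case (Cons x xs)
  show ?case
  proof (cases "x \<in># N")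
    case True
    then obtain N' where N: "N = add_mset x N'" by (metis multi_member_split)
    with Cons.prems have "N' \<subseteq># mset xs" by simp
    with Cons show ?thesis by (simp add: N)
  next
    case False
    then have sub: "N \<subseteq># mset xs"
    proof (intro mset_subset_eqI)
      fix a
      have "count N a \<le> count (add_mset x (mset xs)) a"
        using mset_subset_eq_count[OF Cons.prems(2), of a] by simp
      then show "count N a \<le> count (mset xs) a"
        using False by (cases "a = x") (auto simp: not_in_iff)
    qed
    with Cons have IH: "sum_list (take (size N) xs) \<le> sum_mset N" by simp
    show ?thesis
    proof (cases "size N")
      case (Suc m)
      have "size N \<le> length xs" using size_mset_mono[OF sub] by simp
      with Suc have m: "m < length xs" by simp
      then have "x \<le> xs ! m" using Cons.prems(1) by simp
      with IH m Suc show ?thesis by (simp add: take_Suc_conv_app_nth)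
    qed simp
  qed
qed

text \<open>Carries the conditions on sorted prefixes over to arbitrary sets of servers, as the
  level sets require.\<close>

lemma sum_nth_smallest_le:
  fixes \<mu> :: "real ^ 'n::finite"
  shows "(\<Sum>i=1..card H. nth_smallest \<mu> i) \<le> (\<Sum>i\<in>H. \<mu> $ i)"
proof -
  let ?M = "image_mset (\<lambda>j. \<mu> $ j) (mset_set (UNIV :: 'n set))"
  let ?N = "image_mset (\<lambda>j. \<mu> $ j) (mset_set H)"
  let ?xs = "sorted_list_of_multiset ?M"
  have len: "card H \<le> length ?xs"
    by (simp add: card_mono flip: size_mset)
  have "(\<Sum>i=1..card H. nth_smallest \<mu> i) = (\<Sum>i<card H. ?xs ! i)"
    unfolding nth_smallest_def
    by (rule sum.reindex_bij_witness[of _ Suc "\<lambda>i. i - 1"]) auto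
  also have "\<dots> = sum_list (take (size ?N) ?xs)"
    using len by (simp add: sum_list_sum_nth min_absorb2 atLeast0LessThan)
  also have "\<dots> \<le> sum_mset ?N"
    by (rule sum_take_sorted_le_submultiset)
      (auto intro!: image_mset_subseteq_mono subset_imp_msubset_mset_set)
  also have "\<dots> = (\<Sum>i\<in>H. \<mu> $ i)"
    by (simp add: sum_unfold_sum_mset)
  finally show ?thesis .
qed

lemma choose_less_choose:
  assumes "j < n" "0 < d" "d \<le> n"
  shows "(j choose d) < (n choose d)"
proof -
  obtain m where n: "n = Suc m" using assms by (cases n) auto
  obtain e where d: "d = Suc e" using assms by (cases d) auto
  have "(j choose d) \<le> (m choose d)"
    using assms n by (intro binomial_right_mono) simp
  also have "\<dots> < (n choose d)"
    using assms by (simp add: n d)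
  finally show ?thesis .
qed

lemma capacity_set_subset_sum:
  fixes \<mu> :: "real ^ 'n::finite"
  assumes \<mu>: "\<mu> \<in> capacity_set d" and d: "d \<le> CARD('n)" and H: "H \<noteq> UNIV"
  shows "(\<Sum>i\<in>UNIV. \<mu> $ i) * (real (card H choose d) / real (CARD('n) choose d)) \<le> (\<Sum>i\<in>H. \<mu> $ i)"
proof -
  let ?r = "real (card H choose d) / real (CARD('n) choose d)" and ?s = "\<Sum>i\<in>UNIV. \<mu> $ i"
  have pos: "0 \<le> \<mu> $ i" for i using \<mu> by (simp add: capacity_set_def)
  have cH: "card H < CARD('n)" using H by (intro psubset_card_mono) auto
  show ?thesis
  proof (cases "d \<le> card H")
    case True
    then have "?r \<le> (\<Sum>i=1..card H. nth_smallest \<mu> i) / ?s"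
      using \<mu> cH by (auto simp: capacity_set_def)
    also have "\<dots> \<le> (\<Sum>i\<in>H. \<mu> $ i) / ?s"
      using pos by (intro divide_right_mono sum_nth_smallest_le sum_nonneg) auto
    finally have le: "?r \<le> (\<Sum>i\<in>H. \<mu> $ i) / ?s" .
    \<comment> \<open>Division by zero yields 0, so a positive lower bound on the quotient excludes
      a vanishing total rate.\<close>
    have "0 < ?r" using True d by simp
    with le have "?s \<noteq> 0" by auto
    then have "0 < ?s" using pos by (simp add: sum_nonneg less_le)
    with le show ?thesis by (simp add: field_simps)
  next
    case False
    \<comment> \<open>No sample of size \<open>d\<close> fits into \<open>H\<close>; these are the
      cardinalities for which the region imposes no inequality.\<close>
    then have "(card H choose d) = 0" by simp
    then show ?thesis using pos by (simp add: sum_nonneg del: binomial_eq_0_iff)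
  qed
qed

text \<open>Lowering the service rates of the queues in \<open>H\<close> slightly stays in the capacity region, which
  makes the capacity inequality for \<open>H\<close> strict.\<close>

lemma interior_capacity_set_strict:
  fixes \<mu> :: "real ^ 'n::finite"
  assumes \<mu>: "\<mu> \<in> interior (capacity_set d)" and d: "0 < d" "d \<le> CARD('n)" and H: "H \<noteq> {}" "H \<noteq> UNIV"
  shows "(\<Sum>i\<in>UNIV. \<mu> $ i) * (real (card H choose d) / real (CARD('n) choose d)) < (\<Sum>i\<in>H. \<mu> $ i)"
proof -
  let ?r = "real (card H choose d) / real (CARD('n) choose d)"
  obtain e where e: "0 < e" "cball \<mu> e \<subseteq> capacity_set d"
    using \<mu> by (auto simp: mem_interior_cball)
  \<comment> \<open>Moving each of the \<open>n\<close> coordinates by at most \<eta> keeps the l1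
    norm of the change, hence the Euclidean norm, below \<open>e\<close>.\<close>
  define \<eta> where "\<eta> = e / real CARD('n)"
  have \<eta>: "0 < \<eta>" using e by (simp add: \<eta>_def)
  define \<nu> where "\<nu> = (\<chi> i. \<mu> $ i - (if i \<in> H then \<eta> else 0))"
  have "norm (\<mu> - \<nu>) \<le> (\<Sum>i\<in>UNIV. \<bar>(\<mu> - \<nu>) $ i\<bar>)"
    by (rule norm_le_l1_cart)
  also have "\<dots> \<le> (\<Sum>i\<in>(UNIV :: 'n set). \<eta>)"
    using \<eta> by (intro sum_mono) (auto simp: \<nu>_def)
  also have "\<dots> = e" by (simp add: \<eta>_def)
  finally have "\<nu> \<in> capacity_set d" using e by (auto simp: dist_norm)
  from capacity_set_subset_sum[OF this d(2) H(2)]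
  have "(\<Sum>i\<in>UNIV. \<nu> $ i) * ?r \<le> (\<Sum>i\<in>H. \<nu> $ i)" .
  moreover have "(\<Sum>i\<in>UNIV. \<nu> $ i) = (\<Sum>i\<in>UNIV. \<mu> $ i) - \<eta> * card H"
    by (simp add: \<nu>_def sum_subtractf sum.If_cases)
  moreover have "(\<Sum>i\<in>H. \<nu> $ i) = (\<Sum>i\<in>H. \<mu> $ i) - \<eta> * card H"
    by (simp add: \<nu>_def sum_subtractf)
  ultimately have le: "((\<Sum>i\<in>UNIV. \<mu> $ i) - \<eta> * card H) * ?r \<le> (\<Sum>i\<in>H. \<mu> $ i) - \<eta> * card H"
    by simp
  have "card H < CARD('n)" using H by (intro psubset_card_mono) auto
  then have "(card H choose d) < (CARD('n) choose d)" using d by (intro choose_less_choose)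
  then have "?r < 1" by (subst divide_less_eq_1_pos) (auto simp del: zero_less_binomial_iff)
  moreover have "0 < \<eta> * card H" using \<eta> H by (simp add: card_gt_0_iff)
  \<comment> \<open>Lowering the rates costs the left side only the fraction \<open>?r\<close> of
    what it costs the right side, which is where strictness comes from.\<close>
  ultimately have "\<eta> * card H * ?r < \<eta> * card H" by (metis mult.right_neutral mult_strict_left_mono)
  moreover have "m * r < g" if "(m - h) * r \<le> g - h" "h * r < h" for m h r g :: real
    using that by (simp add: algebra_simps)
  ultimately show ?thesis using le by blast
qed

lemma interior_capacity_set_margin:
  fixes \<mu> :: "real ^ 'n::finite"
  assumes \<mu>: "\<mu> \<in> interior (capacity_set d)" and d: "0 < d" "d \<le> CARD('n)"
  obtains \<delta> where "0 < \<delta>"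
    "\<And>H. H \<noteq> {} \<Longrightarrow> H \<noteq> UNIV \<Longrightarrow>
      (\<Sum>i\<in>UNIV. \<mu> $ i) * (real (card H choose d) / real (CARD('n) choose d)) + \<delta> \<le> (\<Sum>i\<in>H. \<mu> $ i)"
proof
  define g where "g H = (\<Sum>i\<in>H. \<mu> $ i) - (\<Sum>i\<in>UNIV. \<mu> $ i) * (real (card H choose d) / real (CARD('n) choose d))" for H
  \<comment> \<open>Finitely many sets give a positive minimum; \<open>insert 1\<close> covers the
    case of a single server, which has no nonempty proper subset.\<close>
  define \<delta> where "\<delta> = Min (insert 1 (g ` {H. H \<noteq> {} \<and> H \<noteq> UNIV}))"
  have "0 < g H" if "H \<noteq> {}" "H \<noteq> UNIV" for H
    using interior_capacity_set_strict[OF \<mu> d that] by (simp add: g_def)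
  then show "0 < \<delta>"
    unfolding \<delta>_def by (subst Min_gr_iff) auto
  fix H :: "'n set" assume "H \<noteq> {}" "H \<noteq> UNIV"
  then have "\<delta> \<le> g H" unfolding \<delta>_def by (intro Min_le) auto
  then show "(\<Sum>i\<in>UNIV. \<mu> $ i) * (real (card H choose d) / real (CARD('n) choose d)) + \<delta> \<le> (\<Sum>i\<in>H. \<mu> $ i)"
    by (simp add: g_def)
qed

text \<open>The strict inequality for the singleton of \<open>i\<close>, a proper subset since there
  are at least two servers, gives a positive rate at \<open>i\<close>. Consequently the range of
  \<epsilon> is not empty.\<close>

lemma interior_capacity_set_pos:
  fixes \<mu> :: "real ^ 'n::finite"
  assumes \<mu>: "\<mu> \<in> interior (capacity_set d)" and d: "2 \<le> d" "d \<le> CARD('n)"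
  shows "0 < (\<Sum>i\<in>UNIV. \<mu> $ i)"
proof (rule sum_pos)
  have nonneg: "0 \<le> \<mu> $ i" for i
    using \<mu> interior_subset by (auto simp: capacity_set_def)
  fix i :: 'n
  have "{i} \<noteq> UNIV"
  proof
    assume "{i} = UNIV"
    from arg_cong[OF this, of card] d show False by simp
  qed
  then have "(\<Sum>i\<in>UNIV. \<mu> $ i) * (real (card {i} choose d) / real (CARD('n) choose d)) < (\<Sum>i\<in>{i}. \<mu> $ i)"
    using d by (intro interior_capacity_set_strict[OF \<mu>]) auto
  moreover have "0 \<le> (\<Sum>i\<in>UNIV. \<mu> $ i) * (real (card {i} choose d) / real (CARD('n) choose d))"
    using nonneg by (intro mult_nonneg_nonneg sum_nonneg) auto
  ultimately have "0 < (\<Sum>i\<in>{i}. \<mu> $ i)" by linarith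
  then show "0 < \<mu> $ i" by simp
qed auto

subsection \<open>The queue lengths as a Markov chain\<close>

definition law :: "'w measure \<Rightarrow> ('w \<Rightarrow> 'a::countable) \<Rightarrow> 'a pmf" where
  "law M X = Abs_pmf (distr M (count_space UNIV) X)"

lemma (in prob_space) measure_pmf_law:
  assumes "X \<in> measurable M (count_space (UNIV :: 'b::countable set))"
  shows "measure_pmf (law M X) = distr M (count_space UNIV) X"
proof -
  interpret D: prob_space "distr M (count_space UNIV) X"
    using assms by (rule prob_space_distr)
  have "AE x in distr M (count_space UNIV) X. measure (distr M (count_space UNIV) X) {x} \<noteq> 0"
    by (subst D.AE_support_countable) (auto intro!: exI[of _ UNIV])
  then show ?thesis
    unfolding law_def using D.prob_space_axioms by (intro Abs_pmf_inverse) simp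
qed

lemma (in prob_space) pmf_law:
  assumes "X \<in> measurable M (count_space (UNIV :: 'b::countable set))"
  shows "pmf (law M X) x = prob {\<omega> \<in> space M. X \<omega> = x}"
  using assms by (simp add: pmf.rep_eq measure_pmf_law measure_distr vimage_def Int_def conj_commute)

lemma (in prob_space) integral_law:
  fixes f :: "'b::countable \<Rightarrow> 'c::{banach, second_countable_topology}"
  assumes "X \<in> measurable M (count_space UNIV)"
  shows "(\<integral>x. f x \<partial>law M X) = (\<integral>\<omega>. f (X \<omega>) \<partial>M)"
  using assms by (simp add: measure_pmf_law integral_distr)

lemma (in prob_space) AE_law:
  assumes "X \<in> measurable M (count_space (UNIV :: 'b::countable set))" "AE \<omega> in M. P (X \<omega>)"
    and "x \<in> set_pmf (law M X)"
  shows "P x"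
proof -
  have "AE x in law M X. P x"
    unfolding measure_pmf_law[OF assms(1)] using assms(1,2) by (subst AE_distr_iff) auto
  then show ?thesis using assms(3) by (simp add: AE_measure_pmf_iff)
qed

lemma (in prob_space) law_comp:
  fixes f :: "'b::countable \<Rightarrow> 'c::countable"
  assumes X: "X \<in> measurable M (count_space UNIV)" and "\<And>\<omega>. \<omega> \<in> space M \<Longrightarrow> Y \<omega> = f (X \<omega>)"
  shows "law M Y = map_pmf f (law M X)"
proof -
  have "distr M (count_space UNIV) Y = distr M (count_space UNIV) (\<lambda>\<omega>. f (X \<omega>))"
    by (rule distr_cong) (auto simp: assms(2))
  also have "\<dots> = distr (distr M (count_space UNIV) X) (count_space UNIV) f"
    using X by (simp add: distr_distr comp_def)
  also have "\<dots> = measure_pmf (map_pmf f (law M X))"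
    using X by (simp add: map_pmf_rep_eq measure_pmf_law)
  finally show ?thesis
    by (simp add: law_def measure_pmf_inverse)
qed

lemma measurable_Pair_countable:
  fixes X :: "'w \<Rightarrow> 'a::countable" and Y :: "'w \<Rightarrow> 'b::countable"
  assumes "X \<in> measurable M (count_space UNIV)" "Y \<in> measurable M (count_space UNIV)"
  shows "(\<lambda>\<omega>. (X \<omega>, Y \<omega>)) \<in> measurable M (count_space UNIV)"
  using measurable_Pair[OF assms] by (simp add: pair_measure_countable)

text \<open>The conditional law is prescribed only at atoms of \<open>X\<close>. At null values both
  sides vanish, so \<kappa> may be arbitrary there.\<close>

lemma (in prob_space) law_Pair_disintegration:
  fixes X :: "'a \<Rightarrow> 'b::countable" and Y :: "'a \<Rightarrow> 'c::countable"
  assumes X: "X \<in> measurable M (count_space UNIV)" and Y: "Y \<in> measurable M (count_space UNIV)"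
    and cond: "\<And>x y. prob {\<omega> \<in> space M. X \<omega> = x} > 0 \<Longrightarrow>
      prob {\<omega> \<in> space M. X \<omega> = x \<and> Y \<omega> = y} = prob {\<omega> \<in> space M. X \<omega> = x} * pmf (\<kappa> x) y"
  shows "law M (\<lambda>\<omega>. (X \<omega>, Y \<omega>)) = bind_pmf (law M X) (\<lambda>x. map_pmf (Pair x) (\<kappa> x))"
proof (rule pmf_eqI)
  fix z :: "'b \<times> 'c"
  obtain x y where z: "z = (x, y)" by (cases z)
  have "pmf (map_pmf (Pair x') (\<kappa> x')) (x, y) = indicator {x} x' * pmf (\<kappa> x) y" for x'
    by (cases "x' = x") (auto simp: pmf_map_inj' inj_def intro!: pmf_map_outside)
  then have "pmf (bind_pmf (law M X) (\<lambda>x. map_pmf (Pair x) (\<kappa> x))) (x, y) = pmf (law M X) x * pmf (\<kappa> x) y"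
    by (simp add: pmf_bind measure_pmf_single)
  also have "\<dots> = prob {\<omega> \<in> space M. X \<omega> = x \<and> Y \<omega> = y}"
  proof (cases "prob {\<omega> \<in> space M. X \<omega> = x} > 0")
    case True
    then show ?thesis using X by (simp add: pmf_law cond)
  next
    case False
    then have 0: "prob {\<omega> \<in> space M. X \<omega> = x} = 0" by (simp add: zero_less_measure_iff)
    have "prob {\<omega> \<in> space M. X \<omega> = x \<and> Y \<omega> = y} \<le> prob {\<omega> \<in> space M. X \<omega> = x}"
      using X by (intro finite_measure_mono) (auto intro: measurable_sets_Collect)
    with 0 X show ?thesis by (simp add: pmf_law measure_le_0_iff)
  qed
  also have "\<dots> = pmf (law M (\<lambda>\<omega>. (X \<omega>, Y \<omega>))) z"
    using X Y by (simp add: pmf_law measurable_Pair_countable z)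
  finally show "pmf (law M (\<lambda>\<omega>. (X \<omega>, Y \<omega>))) z = pmf (bind_pmf (law M X) (\<lambda>x. map_pmf (Pair x) (\<kappa> x))) z"
    by (simp add: z)
qed

lemma (in prob_space) independent_prob:
  assumes "independent M N X L Y" "A \<in> sets N" "B \<in> sets L"
  shows "prob {\<omega> \<in> space M. X \<omega> \<in> A \<and> Y \<omega> \<in> B} = prob {\<omega> \<in> space M. X \<omega> \<in> A} * prob {\<omega> \<in> space M. Y \<omega> \<in> B}"
proof -
  have "prob ((X -` A \<inter> space M) \<inter> (Y -` B \<inter> space M)) = prob (X -` A \<inter> space M) * prob (Y -` B \<inter> space M)"
    using assms by (intro indep_setD) (auto simp: independent_def)
  moreover have "(X -` A \<inter> space M) \<inter> (Y -` B \<inter> space M) = {\<omega> \<in> space M. X \<omega> \<in> A \<and> Y \<omega> \<in> B}"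
    "X -` A \<inter> space M = {\<omega> \<in> space M. X \<omega> \<in> A}" "Y -` B \<inter> space M = {\<omega> \<in> space M. Y \<omega> \<in> B}"
    by auto
  ultimately show ?thesis by simp
qed

lemma (in prob_space) law_Pair_independent:
  fixes X :: "'a \<Rightarrow> 'b::countable" and Y :: "'a \<Rightarrow> 'c::countable"
  assumes X: "X \<in> measurable M (count_space UNIV)" and Y: "Y \<in> measurable M (count_space UNIV)"
    and ind: "\<And>x y. prob {\<omega> \<in> space M. X \<omega> = x \<and> Y \<omega> = y} = prob {\<omega> \<in> space M. X \<omega> = x} * prob {\<omega> \<in> space M. Y \<omega> = y}"
  shows "law M (\<lambda>\<omega>. (X \<omega>, Y \<omega>)) = pair_pmf (law M X) (law M Y)"
  unfolding pair_pmf_conv_bind_map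
  by (rule law_Pair_disintegration[OF X Y]) (simp add: ind pmf_law Y)

section \<open>Evolution of the queue-length laws\<close>

context power_of_d_choices
begin

abbreviation "hist \<equiv> history a s sel dest q"

lemma last_hist: "last (fst (hist k \<omega>)) = q k \<omega>"
  by (simp add: history_def)

lemma measurable_slot:
  shows measurable_hist: "hist k \<in> measurable M (count_space UNIV)"
    and measurable_a: "a k \<in> measurable M (count_space UNIV)"
    and measurable_s: "s k \<in> measurable M (count_space UNIV)"
    and measurable_sel: "sel k \<in> measurable M (count_space UNIV)"
proof -
  have as: "(\<lambda>\<omega>. (a k \<omega>, s k \<omega>)) \<in> measurable M (count_space UNIV)"
    using current_indep_history[of k] by (simp add: independent_def)
  show "a k \<in> measurable M (count_space UNIV)" "s k \<in> measurable M (count_space UNIV)"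
    using measurable_compose[OF as, of fst "count_space UNIV"] measurable_compose[OF as, of snd "count_space UNIV"]
    by simp_all
  show "hist k \<in> measurable M (count_space UNIV)"
    using current_indep_history[of k] by (simp add: independent_def)
  show "sel k \<in> measurable M (count_space UNIV)"
    using sel_indep[of k] by (simp add: independent_def)
qed

lemma law_arrivals: "law M (a k) = law M (a 1)" and law_services: "law M (s k) = law M (s 1)"
  using iid_arrivals iid_services unfolding iid_seq_def law_def by metis+

lemma law_arrivals_services: "law M (\<lambda>\<omega>. (a k \<omega>, s k \<omega>)) = pair_pmf (law M (a k)) (law M (s k))"
proof (rule law_Pair_independent[OF measurable_a measurable_s])
  fix x y
  have 1: "{f. f k = x} \<in> sets (\<Pi>\<^sub>M k\<in>(UNIV :: nat set). count_space (UNIV :: nat set))"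
    and 2: "{f. f k = y} \<in> sets (\<Pi>\<^sub>M k\<in>(UNIV :: nat set). count_space (UNIV :: (nat ^ 'n) set))"
    using measurable_sets[OF measurable_component_singleton[of k UNIV "\<lambda>_. count_space UNIV"], of "{_}"]
    by (auto simp: space_PiM vimage_def)
  from independent_prob[OF arrivals_indep_services 1 2]
  show "prob {\<omega> \<in> space M. a k \<omega> = x \<and> s k \<omega> = y} = prob {\<omega> \<in> space M. a k \<omega> = x} * prob {\<omega> \<in> space M. s k \<omega> = y}"
    by simp
qed

text \<open>Three independences are stacked: the sample from everything else, the current inputs
  from the history, and the arrivals from the services.\<close>

lemma law_history_slot:
  "law M (\<lambda>\<omega>. (hist k \<omega>, (a k \<omega>, s k \<omega>), sel k \<omega>)) =
   pair_pmf (law M (hist k)) (pair_pmf (pair_pmf (law M (a 1)) (law M (s 1))) (pmf_of_set {D. card D = d}))"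
proof -
  note meas = measurable_hist measurable_a measurable_s measurable_sel measurable_Pair_countable
  have "measure_pmf (law M (sel k)) = measure_pmf (pmf_of_set {D. card D = d})"
    using sel_uniform[of k] by (simp add: measure_pmf_law measurable_sel)
  then have sel: "law M (sel k) = pmf_of_set {D. card D = d}"
    by (simp add: measure_pmf_inject)
  have "law M (\<lambda>\<omega>. ((hist k \<omega>, (a k \<omega>, s k \<omega>)), sel k \<omega>)) =
      pair_pmf (law M (\<lambda>\<omega>. (hist k \<omega>, (a k \<omega>, s k \<omega>)))) (law M (sel k))"
    using independent_prob[OF sel_indep[of k], of "{_}" "{_}"]
    by (intro law_Pair_independent meas) (simp add: conj_commute mult.commute)
  also have "law M (\<lambda>\<omega>. (hist k \<omega>, (a k \<omega>, s k \<omega>))) = pair_pmf (law M (hist k)) (law M (\<lambda>\<omega>. (a k \<omega>, s k \<omega>)))"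
    using independent_prob[OF current_indep_history[of k], of "{_}" "{_}"]
    by (intro law_Pair_independent meas) (simp add: conj_commute mult.commute)
  also have "law M (\<lambda>\<omega>. (a k \<omega>, s k \<omega>)) = pair_pmf (law M (a 1)) (law M (s 1))"
    using law_arrivals_services[of k] law_arrivals[of k] law_services[of k] by simp
  finally have "law M (\<lambda>\<omega>. ((hist k \<omega>, (a k \<omega>, s k \<omega>)), sel k \<omega>)) =
      pair_pmf (pair_pmf (law M (hist k)) (pair_pmf (law M (a 1)) (law M (s 1)))) (pmf_of_set {D. card D = d})"
    by (simp add: sel)
  moreover have "law M (\<lambda>\<omega>. (hist k \<omega>, (a k \<omega>, s k \<omega>), sel k \<omega>)) =
      map_pmf (\<lambda>((h, z), D). (h, z, D)) (law M (\<lambda>\<omega>. ((hist k \<omega>, (a k \<omega>, s k \<omega>)), sel k \<omega>)))"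
    by (rule law_comp) (auto intro!: meas)
  ultimately show ?thesis
    by (simp add: pair_pair_pmf map_pmf_comp case_prod_unfold)
qed

text \<open>The last recorded queue vector in the history is the current one, so
  \<open>last (fst h)\<close> recovers it and the conditional law of the destination is a function
  of history and sample.\<close>

lemma law_history_slot_dest:
  "law M (\<lambda>\<omega>. ((hist k \<omega>, (a k \<omega>, s k \<omega>), sel k \<omega>), dest k \<omega>)) =
   bind_pmf (law M (\<lambda>\<omega>. (hist k \<omega>, (a k \<omega>, s k \<omega>), sel k \<omega>)))
     (\<lambda>w. map_pmf (Pair w) ((\<lambda>(h, z, D). pmf_of_set (shortest (last (fst h)) D)) w))"
proof (rule law_Pair_disintegration)
  fix w :: "((nat ^ 'n) list \<times> (nat \<times> (nat ^ 'n) \<times> 'n set \<times> 'n) list) \<times> (nat \<times> (nat ^ 'n)) \<times> 'n set"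
    and i
  obtain h x y D where w: "w = (h, (x, y), D)" by (cases w) auto
  let ?E = "{\<omega> \<in> space M. hist k \<omega> = h \<and> q k \<omega> = last (fst h) \<and> a k \<omega> = x \<and> s k \<omega> = y \<and> sel k \<omega> = D}"
  have E: "{\<omega> \<in> space M. (hist k \<omega>, (a k \<omega>, s k \<omega>), sel k \<omega>) = w} = ?E"
    using last_hist by (auto simp: w)
  assume "0 < prob {\<omega> \<in> space M. (hist k \<omega>, (a k \<omega>, s k \<omega>), sel k \<omega>) = w}"
  then have pos: "0 < prob ?E" unfolding E .
  have E': "{\<omega> \<in> space M. (hist k \<omega>, (a k \<omega>, s k \<omega>), sel k \<omega>) = w \<and> dest k \<omega> = i} =
      {\<omega> \<in> space M. dest k \<omega> = i \<and> hist k \<omega> = h \<and> q k \<omega> = last (fst h) \<and> a k \<omega> = x \<and> s k \<omega> = y \<and> sel k \<omega> = D}"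
    using last_hist by (auto simp: w)
  have "prob {\<omega> \<in> space M. dest k \<omega> = i \<and> hist k \<omega> = h \<and> q k \<omega> = last (fst h) \<and> a k \<omega> = x \<and> s k \<omega> = y \<and> sel k \<omega> = D}
      = prob ?E * pmf (pmf_of_set (shortest (last (fst h)) D)) i"
    using dest_uniform_shortest[OF pos, of i] pos by (simp add: cond_prob_def field_simps)
  then show "prob {\<omega> \<in> space M. (hist k \<omega>, (a k \<omega>, s k \<omega>), sel k \<omega>) = w \<and> dest k \<omega> = i} =
    prob {\<omega> \<in> space M. (hist k \<omega>, (a k \<omega>, s k \<omega>), sel k \<omega>) = w} *
      pmf ((\<lambda>(h, z, D). pmf_of_set (shortest (last (fst h)) D)) w) i"
    unfolding E E' by (simp add: w)
qed (intro measurable_Pair_countable measurable_slot measurable_dest)+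

lemma queue_next: "\<omega> \<in> space M \<Longrightarrow> q (Suc k) \<omega> = next_queue (q k \<omega>) (a k \<omega>, s k \<omega>, dest k \<omega>)"
proof -
  assume \<omega>: "\<omega> \<in> space M"
  have nat: "x = y + z - w" if "int x = int y + int z - int w + max (int w - int y - int z) 0" for x y z w :: nat
  proof -
    have "int x = int (y + z - w)"
      unfolding that by (cases "w \<le> y + z") (auto simp: max_def of_nat_diff)
    then show ?thesis by (rule of_nat_eq_iff[THEN iffD1])
  qed
  show ?thesis
    unfolding vec_eq_iff
  proof
    fix j
    show "q (Suc k) \<omega> $ j = next_queue (q k \<omega>) (a k \<omega>, s k \<omega>, dest k \<omega>) $ j"
      unfolding next_queue_def prod.case vec_lambda_beta
      by (rule nat[OF queue_dynamics[OF \<omega>, of k j, unfolded unused_service_def]])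
  qed
qed

text \<open>Given the history, the next state depends on it only through the current queue vector.
  Averaging over the sample turns the conditional destination law into
  \<open>dest_pmf\<close>.\<close>

lemma law_queue_Suc: "law M (q (Suc k)) = bind_pmf (law M (q k)) (kernel (law M (a 1)) (law M (s 1)) d)"
proof -
  have q: "law M (q k) = map_pmf (\<lambda>h. last (fst h)) (law M (hist k))"
    by (rule law_comp) (simp_all add: last_hist measurable_hist)
  have "law M (q (Suc k)) = map_pmf (\<lambda>((h, (x, y), D), i). next_queue (last (fst h)) (x, y, i))
      (law M (\<lambda>\<omega>. ((hist k \<omega>, (a k \<omega>, s k \<omega>), sel k \<omega>), dest k \<omega>)))"
    by (rule law_comp) (auto simp: queue_next last_hist intro!: measurable_Pair_countable measurable_slot measurable_dest)
  also have "\<dots> = bind_pmf (law M (q k)) (kernel (law M (a 1)) (law M (s 1)) d)"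
    unfolding law_history_slot_dest law_history_slot q
    by (simp add: kernel_def[abs_def] slot_pmf_def dest_pmf_def pair_pmf_def map_bind_pmf bind_map_pmf map_pmf_comp
        bind_assoc_pmf bind_return_pmf) (simp add: map_pmf_def)
  finally show ?thesis .
qed

end

section \<open>Test functions on the lattice\<close>

lemma dist_real_vec_ge_1:
  fixes v w :: "nat ^ 'n::finite"
  assumes "v \<noteq> w"
  shows "1 \<le> dist (real_vec v) (real_vec w)"
proof -
  obtain i where i: "v $ i \<noteq> w $ i" using assms by (auto simp: vec_eq_iff)
  then have "real (v $ i) + 1 \<le> real (w $ i) \<or> real (w $ i) + 1 \<le> real (v $ i)" by linarith
  then have "1 \<le> \<bar>(real_vec v - real_vec w) $ i\<bar>" by (auto simp: real_vec_def)
  also have "\<dots> \<le> norm (real_vec v - real_vec w)" by (rule component_le_norm_cart)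
  finally show ?thesis by (simp add: dist_norm)
qed

text \<open>The lattice is closed and discrete, so by Tietze's theorem each bounded function on it extends
  to a bounded continuous function.\<close>

lemma bounded_lattice_function_extends:
  fixes g :: "nat ^ 'n::finite \<Rightarrow> real"
  assumes g: "\<And>v. \<bar>g v\<bar> \<le> B"
  obtains f :: "real ^ 'n \<Rightarrow> real"
    where "continuous_on UNIV f" "bounded (range f)" "\<And>v. f (real_vec v) = g v"
proof -
  let ?L = "range (real_vec :: nat ^ 'n \<Rightarrow> _)"
  have inj: "inj (real_vec :: nat ^ 'n \<Rightarrow> _)"
    by (auto simp: inj_def real_vec_def vec_eq_iff)
  have disc: "x = y" if "x \<in> ?L" "y \<in> ?L" "dist y x < 1" for x y
  proof (rule ccontr)
    assume "x \<noteq> y"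
    moreover obtain v w where "x = real_vec v" "y = real_vec w" using \<open>x \<in> ?L\<close> \<open>y \<in> ?L\<close> by auto
    ultimately show False using dist_real_vec_ge_1[of w v] \<open>dist y x < 1\<close> by auto
  qed
  have "closed ?L" 
    by (rule discrete_imp_closed[of 1]) (auto simp only: zero_less_one intro!: disc[symmetric])
  then have cl: "closedin (top_of_set UNIV) ?L" by simp
  have cont: "continuous_on ?L (\<lambda>x. g (inv real_vec x))"
    unfolding continuous_on_iff
  proof (intro ballI allI impI exI[of _ 1] conjI)
    fix x e x' assume "x \<in> ?L" "0 < (e :: real)" "x' \<in> ?L" "dist x' x < 1"
    then show "dist (g (inv real_vec x')) (g (inv real_vec x)) < e"
      using disc[of x x'] by simp
  qed simp
  show thesis
  proof (rule Tietze[OF cont cl order.trans[OF abs_ge_zero g]])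
    show "norm (g (inv real_vec x)) \<le> B" for x using g by simp
    fix f assume f: "continuous_on UNIV f" "\<And>x. x \<in> ?L \<Longrightarrow> f x = g (inv real_vec x)"
      "\<And>x. x \<in> UNIV \<Longrightarrow> norm (f x) \<le> B"
    show thesis
    proof (rule that[OF f(1)])
      show "bounded (range f)" using f(3) by (auto simp: bounded_iff)
      show "f (real_vec v) = g v" for v using f(2) inj by simp
    qed
  qed
qed

text \<open>Both sides of the one-step recursion are passed to the limit. The probability of moving
  from \<open>v\<close> to a fixed \<open>w\<close> is a bounded function of \<open>v\<close>, hence
  the restriction of a bounded continuous function and an admissible test function for weak
  convergence.\<close>

lemma (in power_of_d_choices) limit_law_stationary:
  assumes N: "prob_space N" and qbar: "qbar \<in> measurable N (count_space UNIV)"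
    and lim: "converges_in_distribution sequentially (\<lambda>_. M) (\<lambda>k \<omega>. real_vec (q k \<omega>)) N (\<lambda>\<omega>. real_vec (qbar \<omega>))"
  shows "law N qbar = bind_pmf (law N qbar) (kernel (law M (a 1)) (law M (s 1)) d)"
proof (rule pmf_eqI)
  fix w
  let ?K = "kernel (law M (a 1)) (law M (s 1)) d" and ?\<pi> = "law N qbar"
  have conv: "(\<lambda>k. \<integral>v. g v \<partial>law M (q k)) \<longlonglongrightarrow> (\<integral>v. g v \<partial>?\<pi>)" if g: "\<And>v. \<bar>g v\<bar> \<le> 1"
    for g :: "nat ^ 'n \<Rightarrow> real"
  proof -
    obtain f :: "real ^ 'n \<Rightarrow> real" where f: "continuous_on UNIV f" "bounded (range f)" "\<And>v. f (real_vec v) = g v"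
      using bounded_lattice_function_extends[of g 1] g by blast
    from lim f(1,2) have "(\<lambda>k. \<integral>\<omega>. f (real_vec (q k \<omega>)) \<partial>M) \<longlonglongrightarrow> (\<integral>\<omega>. f (real_vec (qbar \<omega>)) \<partial>N)"
      by (auto simp: converges_in_distribution_def)
    then show ?thesis
      by (simp add: f(3) integral_law measurable_q prob_space.integral_law[OF N qbar])
  qed
  have "(\<lambda>k. pmf (law M (q (Suc k))) w) \<longlonglongrightarrow> pmf ?\<pi> w"
    using LIMSEQ_Suc[OF conv[of "indicator {w}"]] by (simp add: measure_pmf_single)
  moreover have "(\<lambda>k. pmf (law M (q (Suc k))) w) \<longlonglongrightarrow> pmf (bind_pmf ?\<pi> ?K) w"
    unfolding law_queue_Suc pmf_bind by (rule conv) (simp add: pmf_le_1)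
  ultimately show "pmf ?\<pi> w = pmf (bind_pmf ?\<pi> ?K) w"
    by (rule LIMSEQ_unique)
qed

subsection \<open>Weak limits\<close>

lemma char_exponential:
  assumes l: "0 < l"
  shows "char (density lborel (exponential_density l)) t = 1 / (1 - \<i> * t / l)"
proof -
  let ?D = "density lborel (exponential_density l)"
  \<comment> \<open>The real part of \<open>c\<close> is \<open>- l\<close>, so the antiderivative
    \<open>?F\<close> vanishes at infinity and the integral equals \<open>- l / c\<close>.\<close>
  define c where "c = \<i> * t - l"
  have c: "c \<noteq> 0" using l by (auto simp: c_def complex_eq_iff)
  interpret prob_space ?D by (rule prob_space_exponential_density[OF l])
  let ?f = "\<lambda>x::real. l * exp (c * x)" and ?F = "\<lambda>x::real. l / c * exp (c * x)"
  have "integrable ?D (\<lambda>x. iexp (t * x))"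
    by (rule integrable_const_bound[of _ 1]) auto
  then have int: "integrable lborel (\<lambda>x. exponential_density l x *\<^sub>R iexp (t * x))"
    by (subst (asm) integrable_density) (auto simp: exponential_density_nonneg[OF l])
  have pw: "exponential_density l x *\<^sub>R iexp (t * x) = indicator (einterval 0 \<infinity>) x *\<^sub>R ?f x" if "x \<noteq> 0" for x
    using that by (auto simp: exponential_density_def einterval_def c_def scaleR_conv_of_real
        exp_of_real[symmetric] algebra_simps simp flip: exp_add split: split_indicator)
  \<comment> \<open>The density is positive at 0 while the open interval leaves 0 out; one point is
    a null set.\<close>
  have AE: "AE x in lborel. exponential_density l x *\<^sub>R iexp (t * x) = indicator (einterval 0 \<infinity>) x *\<^sub>R ?f x"
    using AE_lborel_singleton[of "0::real"] by eventually_elim (rule pw)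
  have sint: "set_integrable lborel (einterval 0 \<infinity>) ?f"
    unfolding set_integrable_def
    by (rule integrable_cong_AE_imp[OF int]) (use AE in \<open>auto elim!: eventually_mono\<close>)
  have lim0: "((?F \<circ> real_of_ereal) \<longlongrightarrow> l / c) (at_right 0)"
  proof -
    have "(?F \<longlongrightarrow> ?F 0) (at_right 0)"
      by (intro tendsto_intros)
    then show ?thesis
      using c by (simp add: zero_ereal_def ereal_tendsto_simps)
  qed
  have limi: "((?F \<circ> real_of_ereal) \<longlongrightarrow> 0) (at_left \<infinity>)"
  proof -
    have "((\<lambda>x. norm (l / c) * exp (- l * x)) \<longlongrightarrow> 0) at_top"
      using l by real_asymp
    moreover have "norm (?F x) = norm (l / c) * exp (- l * x)" for x
      unfolding norm_mult norm_exp_eq_Re by (simp add: c_def)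
    ultimately have "(?F \<longlongrightarrow> 0) at_top"
      by (intro Lim_null_comparison[of ?F "\<lambda>x. norm (l / c) * exp (- l * x)"]) simp_all
    then show ?thesis by (simp add: ereal_tendsto_simps)
  qed
  have "char ?D t = (\<integral>x. exponential_density l x *\<^sub>R iexp (t * x) \<partial>lborel)"
    unfolding char_def by (subst integral_density) (auto simp: exponential_density_nonneg[OF l])
  also have "\<dots> = (\<integral>x. indicator (einterval 0 \<infinity>) x *\<^sub>R ?f x \<partial>lborel)"
    by (rule integral_cong_AE) (use AE in auto)
  also have "\<dots> = (LBINT x=0..\<infinity>. ?f x)"
    by (simp only: interval_lebesgue_integral_def set_lebesgue_integral_def ereal_less_eq if_True)
  also have "\<dots> = 0 - l / c"
  proof (rule interval_integral_FTC_integrable[OF _ _ _ sint lim0 limi])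
    show "(?F has_vector_derivative ?f x) (at x)" for x
    proof -
      have "((\<lambda>z. l / c * exp (c * z)) has_field_derivative ?f x) (at (of_real x))"
        using c by (auto intro!: derivative_eq_intros)
      from has_vector_derivative_real_field[OF this] show ?thesis .
    qed
    show "isCont ?f x" for x by (intro continuous_intros)
  qed simp
  also have "\<dots> = 1 / (1 - \<i> * t / l)"
    using l c by (simp add: c_def field_simps)
  finally show ?thesis .
qed

text \<open>The point mass at zero is included: for \<open>m = 0\<close> the formula gives
  1.\<close>

lemma char_exponential_with_mean:
  assumes "prob_space P" "Y \<in> borel_measurable P" "exponential_with_mean P Y m" "0 \<le> m"
  shows "char (distr P borel Y) t = 1 / (1 - \<i> * t * m)"
proof (cases "m = 0")
  case True
  then have "distr P borel Y = return borel 0"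
    using assms(3) by (simp add: exponential_with_mean_def)
  then show ?thesis using True by (simp add: char_def integral_return)
next
  case False
  then have "distributed P lborel Y (exponential_density (1 / m))"
    using assms(3) by (simp add: exponential_with_mean_def)
  then have "distr P lborel Y = density lborel (exponential_density (1 / m))"
    by (simp add: distributed_def)
  moreover have "distr P borel Y = distr P lborel Y"
    by (rule distr_cong) auto
  ultimately show ?thesis
    using char_exponential[of "1 / m" t] False assms(4) by simp
qed

text \<open>At \<tau> = t \<epsilon> / n the main terms of \<open>transform_estimate\<close> are
  \<epsilon>^2 times expressions in \<open>K\<close>, and after division by \<epsilon>^2 the error
  \<open>R\<close> still vanishes, its slowest part like the square root of \<epsilon>. The limit of
  \<phi> then follows on dividing by \<open>K\<close>.\<close>

lemma heavy_traffic_char: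
  fixes A :: "real \<Rightarrow> nat pmf" and S :: "(nat ^ 'n::finite) pmf" and \<pi> :: "real \<Rightarrow> (nat ^ 'n) pmf"
  assumes model: "\<forall>\<^sub>F \<epsilon> in at_right 0. stationary_load_balancer (A \<epsilon>) S d b (\<pi> \<epsilon>) \<epsilon> C"
    and moment: "((\<lambda>\<epsilon>. load_balancer.net_second_moment (A \<epsilon>) S) \<longlongrightarrow> m) (at_right 0)"
  shows "((\<lambda>\<epsilon>. \<integral>v. iexp (t * (\<epsilon> / real CARD('n) * queue_total v)) \<partial>\<pi> \<epsilon>)
    \<longlongrightarrow> 1 / (1 - \<i> * t * (m / (2 * real CARD('n))))) (at_right 0)"
proof (cases "t = 0")
  case True
  then show ?thesis by simp
next
  case t: False
  let ?n = "real CARD('n)"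
  define \<phi> where "\<phi> \<epsilon> = (\<integral>v. iexp (t * (\<epsilon> / ?n * queue_total v)) \<partial>\<pi> \<epsilon>)" for \<epsilon>
  define m\<^sub>2 where "m\<^sub>2 \<epsilon> = load_balancer.net_second_moment (A \<epsilon>) S" for \<epsilon>
  define K where "K x = \<i> * t / ?n + t\<^sup>2 * x / (2 * ?n\<^sup>2)" for x :: real
  define R where "R \<epsilon> = \<bar>t\<bar> ^ 3 / ?n ^ 3 * \<epsilon> * (?n * b) ^ 3 / 6 + t\<^sup>2 / ?n\<^sup>2 * (?n * b * \<epsilon>) / 2
      + t\<^sup>2 / ?n\<^sup>2 * (?n * sqrt \<epsilon> * (C + ?n * b) / 2)" for \<epsilon>
  have est: "\<forall>\<^sub>F \<epsilon> in at_right 0. norm (\<phi> \<epsilon> * K (m\<^sub>2 \<epsilon>) - \<i> * t / ?n) \<le> R \<epsilon>"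
    using model eventually_at_right_less[of "0::real"]
  proof eventually_elim
    case (elim \<epsilon>)
    interpret stationary_load_balancer "A \<epsilon>" S d b "\<pi> \<epsilon>" \<epsilon> C by (rule elim(1))
    define \<tau> where "\<tau> = t * \<epsilon> / ?n"
    have \<phi>: "(\<integral>v. iexp (\<tau> * queue_total v) \<partial>\<pi> \<epsilon>) = \<phi> \<epsilon>"
      by (simp add: \<phi>_def \<tau>_def mult.assoc)
    have "\<epsilon>\<^sup>2 * norm (\<phi> \<epsilon> * K (m\<^sub>2 \<epsilon>) - \<i> * t / ?n) =
        norm (complex_of_real (\<epsilon>\<^sup>2) * (\<phi> \<epsilon> * K (m\<^sub>2 \<epsilon>) - \<i> * t / ?n))"
      by (simp add: norm_mult norm_power)
    also have "complex_of_real (\<epsilon>\<^sup>2) * (\<phi> \<epsilon> * K (m\<^sub>2 \<epsilon>) - \<i> * t / ?n) =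
        \<phi> \<epsilon> * (\<i> * \<tau> * \<epsilon> + \<tau>\<^sup>2 * m\<^sub>2 \<epsilon> / 2) - \<i> * \<tau> * \<epsilon>"
      by (simp add: K_def \<tau>_def field_simps power2_eq_square)
    also have "norm \<dots> \<le> \<bar>\<tau>\<bar> ^ 3 * (?n * b) ^ 3 / 6 + \<tau>\<^sup>2 * (?n * b * \<epsilon>) / 2
        + \<tau>\<^sup>2 * (?n * sqrt \<epsilon> * (C + ?n * b) / 2)"
      using transform_estimate[of \<tau>] unfolding \<phi> m\<^sub>2_def .
    also have "\<dots> = \<epsilon>\<^sup>2 * R \<epsilon>"
      using elim(2) by (simp add: R_def \<tau>_def abs_mult power_mult_distrib power_divide
          power2_eq_square power3_eq_cube algebra_simps)
    finally show ?case using elim(2) by simp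
  qed
  have R0: "(R \<longlongrightarrow> 0) (at_right 0)"
  proof -
    have "(R \<longlongrightarrow> \<bar>t\<bar> ^ 3 / ?n ^ 3 * 0 * (?n * b) ^ 3 / 6 + t\<^sup>2 / ?n\<^sup>2 * (?n * b * 0) / 2
      + t\<^sup>2 / ?n\<^sup>2 * (?n * sqrt 0 * (C + ?n * b) / 2)) (at_right 0)"
      unfolding R_def by (intro tendsto_intros) auto
    then show ?thesis by simp
  qed
  have "((\<lambda>\<epsilon>. \<phi> \<epsilon> * K (m\<^sub>2 \<epsilon>) - \<i> * t / ?n) \<longlongrightarrow> 0) (at_right 0)"
    by (rule Lim_null_comparison[OF est R0])
  then have 1: "((\<lambda>\<epsilon>. \<phi> \<epsilon> * K (m\<^sub>2 \<epsilon>)) \<longlongrightarrow> \<i> * t / ?n) (at_right 0)"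
    by (rule LIM_zero_cancel)
  have 2: "((\<lambda>\<epsilon>. K (m\<^sub>2 \<epsilon>)) \<longlongrightarrow> K m) (at_right 0)"
    unfolding K_def m\<^sub>2_def by (intro tendsto_intros moment) auto
  \<comment> \<open>The imaginary part of \<open>K x\<close> is \<open>t / n\<close>, whatever the
    second moment \<open>x\<close>.\<close>
  have nz: "K x \<noteq> 0" for x using t by (simp add: K_def complex_eq_iff)
  have "((\<lambda>\<epsilon>. \<phi> \<epsilon> * K (m\<^sub>2 \<epsilon>) / K (m\<^sub>2 \<epsilon>)) \<longlongrightarrow> (\<i> * t / ?n) / K m) (at_right 0)"
    by (intro tendsto_divide 1 2 nz)
  moreover have "(\<i> * t / ?n) / K m = 1 / (1 - \<i> * t * (m / (2 * ?n)))"
  proof -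
    have "K m = (\<i> * t / ?n) * (1 - \<i> * t * (m / (2 * ?n)))"
      by (simp add: K_def field_simps power2_eq_square)
    then show ?thesis using t by simp
  qed
  ultimately show ?thesis
    unfolding \<phi>_def using nz by simp
qed

section \<open>From the average queue length to the whole vector\<close>

lemma norm_scaled_queue_diff_le:
  fixes v :: "nat ^ 'n::finite"
  assumes "0 \<le> e"
  shows "norm (e *\<^sub>R real_vec v - (e / real CARD('n) * queue_total v) *\<^sub>R 1) \<le> real CARD('n) * e * queue_spread v"
proof -
  let ?n = "real CARD('n)"
  have "\<bar>(e *\<^sub>R real_vec v - (e / ?n * queue_total v) *\<^sub>R 1) $ i\<bar> \<le> e * queue_spread v" for i
  proof -
    \<comment> \<open>The deviation of a coordinate from the mean is the average of its differences
      to all coordinates.\<close>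
    have "(e *\<^sub>R real_vec v - (e / ?n * queue_total v) *\<^sub>R 1) $ i = e / ?n * (\<Sum>j\<in>UNIV. real (v $ i) - real (v $ j))"
      by (simp add: real_vec_def sum_subtractf field_simps)
    also have "\<bar>\<dots>\<bar> = e / ?n * \<bar>\<Sum>j\<in>UNIV. real (v $ i) - real (v $ j)\<bar>"
      using assms by (simp add: abs_mult)
    also have "\<dots> \<le> e / ?n * (?n * queue_spread v)"
    proof (rule mult_left_mono)
      have "\<bar>\<Sum>j\<in>UNIV. real (v $ i) - real (v $ j)\<bar> \<le> (\<Sum>j\<in>UNIV. \<bar>real (v $ i) - real (v $ j)\<bar>)"
        by (rule sum_abs)
      also have "\<dots> \<le> (\<Sum>j\<in>(UNIV :: 'n set). queue_spread v)"
        by (intro sum_mono) (rule abs_diff_le_spread[of "\<lambda>i. real (v $ i)"])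
      finally show "\<bar>\<Sum>j\<in>UNIV. real (v $ i) - real (v $ j)\<bar> \<le> ?n * queue_spread v" by simp
    qed (use assms in simp)
    finally show ?thesis by simp
  qed
  then have "(\<Sum>i\<in>UNIV. \<bar>(e *\<^sub>R real_vec v - (e / ?n * queue_total v) *\<^sub>R 1) $ i\<bar>) \<le> (\<Sum>i\<in>(UNIV :: 'n set). e * queue_spread v)"
    by (intro sum_mono)
  with norm_le_l1_cart[of "e *\<^sub>R real_vec v - (e / ?n * queue_total v) *\<^sub>R 1"]
  show ?thesis by simp
qed

text \<open>Being bounded and continuous, this cutoff turns weak convergence into uniform tightness.\<close>

lemma cutoff_integral_small:
  assumes "real_distribution \<mu>" "0 < \<eta>"
  obtains K :: nat where "(\<integral>x. min 1 (max 0 (\<bar>x\<bar> - real K)) \<partial>\<mu>) < \<eta>"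
proof -
  interpret real_distribution \<mu> by fact
  have "(\<lambda>K. \<integral>x. min 1 (max 0 (\<bar>x\<bar> - real K)) \<partial>\<mu>) \<longlonglongrightarrow> (\<integral>x. 0 \<partial>\<mu>)"
  proof (rule integral_dominated_convergence[where w = "\<lambda>_. 1"])
    show "AE x in \<mu>. (\<lambda>K. min 1 (max 0 (\<bar>x\<bar> - real K))) \<longlonglongrightarrow> 0"
    proof (rule AE_I2, rule tendsto_eventually)
      fix x :: real
      obtain k where k: "\<bar>x\<bar> \<le> real k" using real_arch_simple by blast
      show "\<forall>\<^sub>F K in sequentially. min 1 (max 0 (\<bar>x\<bar> - real K)) = 0"
        using eventually_ge_at_top[of k] by eventually_elim (use k in auto)
    qed
  qed auto
  then have "\<forall>\<^sub>F K in sequentially. (\<integral>x. min 1 (max 0 (\<bar>x\<bar> - real K)) \<partial>\<mu>) < \<eta>"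
    using assms(2) by (intro order_tendstoD(2)[of _ 0]) auto
  then show thesis using that by (auto simp: eventually_sequentially)
qed

text \<open>A Slutsky argument: the averages converge weakly and the scaled spread tends to 0 in
  mean square. Since \<open>f\<close> need not be uniformly continuous, it is compared only on a
  compact ball, with tightness controlling the rest.\<close>

lemma weak_convergence_to_diagonal:
  fixes \<pi> :: "nat \<Rightarrow> (nat ^ 'n::finite) pmf" and f :: "real ^ 'n \<Rightarrow> real"
  assumes e: "\<And>k. 0 < e k" "e \<longlonglongrightarrow> 0"
    and collapse: "\<forall>\<^sub>F k in sequentially. integrable (\<pi> k) (\<lambda>v. (queue_spread v)\<^sup>2) \<and> (\<integral>v. (queue_spread v)\<^sup>2 \<partial>\<pi> k) \<le> C"
    and \<mu>: "real_distribution \<mu>"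
    and weak: "weak_conv_m (\<lambda>k. distr (\<pi> k) borel (\<lambda>v. e k / real CARD('n) * queue_total v)) \<mu>"
    and f: "continuous_on UNIV f" "bounded (range f)"
  shows "(\<lambda>k. \<integral>v. f (e k *\<^sub>R real_vec v) \<partial>\<pi> k) \<longlonglongrightarrow> (\<integral>x. f (x *\<^sub>R 1) \<partial>\<mu>)"
proof -
  let ?n = "real CARD('n)"
  let ?X = "\<lambda>k v. e k / ?n * queue_total v"
  have conv: "(\<lambda>k. \<integral>v. g (?X k v) \<partial>\<pi> k) \<longlonglongrightarrow> (\<integral>x. g x \<partial>\<mu>)"
    if g: "continuous_on UNIV g" "\<And>x. norm (g x) \<le> B" for g :: "real \<Rightarrow> real" and B
  proof -
    have "\<And>x. isCont g x" using g(1) by (simp add: continuous_on_eq_continuous_at)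
    moreover have "real_distribution (distr (\<pi> k) borel (?X k))" for k
      by (intro prob_space.real_distribution_distr[OF prob_space_measure_pmf]) simp
    ultimately have "(\<lambda>k. integral\<^sup>L (distr (\<pi> k) borel (?X k)) g) \<longlonglongrightarrow> integral\<^sup>L \<mu> g"
      using weak_conv_imp_integral_bdd_continuous_conv[OF _ \<mu> weak] g(2) by blast
    moreover have "g \<in> borel_measurable borel" using g(1) by (rule borel_measurable_continuous_onI)
    ultimately show ?thesis by (simp add: integral_distr)
  qed
  obtain B where B: "0 < B" "\<And>x. \<bar>f x\<bar> \<le> B"
    using f(2) by (auto simp: bounded_pos)
  have contg: "continuous_on UNIV (\<lambda>x. f (x *\<^sub>R 1))"
    by (rule continuous_on_compose2[OF f(1)]) (auto intro!: continuous_intros)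
  have main: "(\<lambda>k. \<integral>v. f (?X k v *\<^sub>R 1) \<partial>\<pi> k) \<longlonglongrightarrow> (\<integral>x. f (x *\<^sub>R 1) \<partial>\<mu>)"
    by (rule conv[OF contg, of B]) (simp add: B)
  have intf: "integrable (\<pi> k) (\<lambda>v. f (h v))" for k h
    by (rule integrable_pmf_bounded[where B = B]) (simp add: B)
  have "(\<lambda>k. (\<integral>v. f (e k *\<^sub>R real_vec v) \<partial>\<pi> k) - (\<integral>v. f (?X k v *\<^sub>R 1) \<partial>\<pi> k)) \<longlonglongrightarrow> 0"
    unfolding tendsto_iff dist_norm
  proof (intro allI impI)
    fix \<eta> :: real assume \<eta>: "0 < \<eta>"
    \<comment> \<open>The three errors below add up to \<open>(2 * B + 2) * \<eta>'\<close>; the 3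
      leaves room for a strict inequality.\<close>
    define \<eta>' where "\<eta>' = \<eta> / (2 * B + 3)"
    have pos: "0 < \<eta>'" and "\<eta>' * (2 * B + 3) = \<eta>"
      using \<eta> B(1) by (simp_all add: \<eta>'_def)
    then have \<eta>': "0 < \<eta>'" "\<eta>' + 2 * B * \<eta>' + \<eta>' < \<eta>"
      by (simp_all add: algebra_simps)
    obtain K where K: "(\<integral>x. min 1 (max 0 (\<bar>x\<bar> - real K)) \<partial>\<mu>) < \<eta>'"
      by (rule cutoff_integral_small[OF \<mu> \<eta>'(1)])
    let ?h = "\<lambda>x. min 1 (max 0 (\<bar>x\<bar> - real K))"
    have "(\<lambda>k. \<integral>v. ?h (?X k v) \<partial>\<pi> k) \<longlonglongrightarrow> (\<integral>x. ?h x \<partial>\<mu>)"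
      by (rule conv[of ?h 1]) (auto intro!: continuous_intros)
    from order_tendstoD(2)[OF this K] have tight: "\<forall>\<^sub>F k in sequentially. (\<integral>v. ?h (?X k v) \<partial>\<pi> k) < \<eta>'" .
    \<comment> \<open>The ball must contain the diagonal point, whose coordinate is below
      \<open>K + 1\<close>, and the true vector, which lies within \<delta> \<le> 1 of it.\<close>
    define R where "R = (real K + 1) * norm (1 :: real ^ 'n) + 1"
    have "uniformly_continuous_on (cball 0 R) f"
      using f(1) by (intro compact_uniformly_continuous continuous_on_subset[OF f(1)]) auto
    then obtain \<delta>\<^sub>0 where \<delta>\<^sub>0: "0 < \<delta>\<^sub>0" "\<And>x y. x \<in> cball 0 R \<Longrightarrow> y \<in> cball 0 R \<Longrightarrow> dist y x < \<delta>\<^sub>0 \<Longrightarrow> dist (f y) (f x) < \<eta>'"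
      using \<eta>'(1) unfolding uniformly_continuous_on_def by blast
    define \<delta> where "\<delta> = min \<delta>\<^sub>0 1"
    have \<delta>: "0 < \<delta>" "\<delta> \<le> \<delta>\<^sub>0" "\<delta> \<le> 1" using \<delta>\<^sub>0 by (auto simp: \<delta>_def)
    have pw: "\<bar>f (e k *\<^sub>R real_vec v) - f (?X k v *\<^sub>R 1)\<bar>
        \<le> \<eta>' + 2 * B * ?h (?X k v) + 2 * B * (?n * e k / \<delta>)\<^sup>2 * (queue_spread v)\<^sup>2" for k v
    proof -
      have triv: "\<bar>f (e k *\<^sub>R real_vec v) - f (?X k v *\<^sub>R 1)\<bar> \<le> 2 * B"
        using B(2)[of "e k *\<^sub>R real_vec v"] B(2)[of "?X k v *\<^sub>R 1"] by linarith
      have h0: "0 \<le> 2 * B * ?h (?X k v)" and s0: "0 \<le> 2 * B * (?n * e k / \<delta>)\<^sup>2 * (queue_spread v)\<^sup>2"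
        using B by auto
      have diff: "norm (e k *\<^sub>R real_vec v - ?X k v *\<^sub>R 1) \<le> ?n * e k * queue_spread v"
        using e(1)[of k] by (intro norm_scaled_queue_diff_le) simp
      \<comment> \<open>Far out on the diagonal the cutoff equals 1; far off the diagonal the scaled
        squared spread is at least 1, as in Chebyshev's inequality; otherwise uniform continuity
        applies.\<close>
      consider "real K + 1 \<le> \<bar>?X k v\<bar>" | "\<delta> \<le> ?n * e k * queue_spread v"
        | "\<bar>?X k v\<bar> < real K + 1" "?n * e k * queue_spread v < \<delta>" by linarith
      then show ?thesis
      proof cases
        case 1
        then have "?h (?X k v) = 1" by simp
        show ?thesis unfolding \<open>?h (?X k v) = 1\<close> using triv s0 \<eta>'(1) by linarith
      next
        case 2
        then have "1 \<le> ?n * e k / \<delta> * queue_spread v" using \<delta> by (simp add: field_simps)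
        then have "1 \<le> (?n * e k / \<delta> * queue_spread v)\<^sup>2" by (simp add: one_le_power)
        then have "2 * B * 1 \<le> 2 * B * ((?n * e k / \<delta>)\<^sup>2 * (queue_spread v)\<^sup>2)"
          using B by (intro mult_left_mono) (simp_all only: power_mult_distrib[symmetric])
        then show ?thesis using triv h0 \<eta>'(1) unfolding mult.assoc by linarith
      next
        case 3
        have "norm (?X k v *\<^sub>R (1 :: real ^ 'n)) \<le> (real K + 1) * norm (1 :: real ^ 'n)"
          unfolding norm_scaleR real_norm_def using 3(1) by (intro mult_right_mono) auto
        moreover have "norm (e k *\<^sub>R real_vec v) \<le> norm (?X k v *\<^sub>R (1 :: real ^ 'n)) + norm (e k *\<^sub>R real_vec v - ?X k v *\<^sub>R 1)"
          by (rule norm_triangle_sub)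
        ultimately have "?X k v *\<^sub>R (1 :: real ^ 'n) \<in> cball 0 R" "e k *\<^sub>R real_vec v \<in> cball 0 R"
          using diff 3(2) \<delta>(3) by (simp_all only: R_def mem_cball_0)
        moreover have "dist (e k *\<^sub>R real_vec v) (?X k v *\<^sub>R 1) < \<delta>\<^sub>0"
          unfolding dist_norm using diff 3(2) \<delta>(2) by linarith
        ultimately have "dist (f (e k *\<^sub>R real_vec v)) (f (?X k v *\<^sub>R 1)) < \<eta>'"
          by (intro \<delta>\<^sub>0(2))
        then show ?thesis using h0 s0 unfolding dist_real_def by linarith
      qed
    qed
    have "(\<lambda>k. 2 * B * (?n * e k / \<delta>)\<^sup>2 * C) \<longlonglongrightarrow> 2 * B * (?n * 0 / \<delta>)\<^sup>2 * C"
      using \<delta> by (intro tendsto_intros e(2)) auto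
    then have small: "\<forall>\<^sub>F k in sequentially. 2 * B * (?n * e k / \<delta>)\<^sup>2 * C < \<eta>'"
      using \<eta>'(1) by (intro order_tendstoD(2)) auto
    show "\<forall>\<^sub>F k in sequentially.
        norm ((\<integral>v. f (e k *\<^sub>R real_vec v) \<partial>\<pi> k) - (\<integral>v. f (?X k v *\<^sub>R 1) \<partial>\<pi> k) - 0) < \<eta>"
      using tight small collapse
    proof eventually_elim
      case (elim k)
      let ?W2 = "\<lambda>v. (queue_spread v)\<^sup>2"
      have inth: "integrable (\<pi> k) (\<lambda>v. ?h (?X k v))"
        by (rule integrable_pmf_bounded[where B = 1]) auto
      have "norm ((\<integral>v. f (e k *\<^sub>R real_vec v) \<partial>\<pi> k) - (\<integral>v. f (?X k v *\<^sub>R 1) \<partial>\<pi> k) - 0)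
          = norm (\<integral>v. f (e k *\<^sub>R real_vec v) - f (?X k v *\<^sub>R 1) \<partial>\<pi> k)"
        by (simp add: intf)
      also have "\<dots> \<le> (\<integral>v. \<bar>f (e k *\<^sub>R real_vec v) - f (?X k v *\<^sub>R 1)\<bar> \<partial>\<pi> k)"
        using integral_norm_bound[of "\<pi> k" "\<lambda>v. f (e k *\<^sub>R real_vec v) - f (?X k v *\<^sub>R 1)"] by simp
      also have "\<dots> \<le> (\<integral>v. \<eta>' + 2 * B * ?h (?X k v) + 2 * B * (?n * e k / \<delta>)\<^sup>2 * ?W2 v \<partial>\<pi> k)"
        using elim(3) inth pw
        by (intro integral_mono Bochner_Integration.integrable_add integrable_mult_right
            integrable_abs Bochner_Integration.integrable_diff intf) auto
      also have "\<dots> = \<eta>' + 2 * B * (\<integral>v. ?h (?X k v) \<partial>\<pi> k) + 2 * B * (?n * e k / \<delta>)\<^sup>2 * (\<integral>v. ?W2 v \<partial>\<pi> k)"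
        using elim(3) inth by simp
      also have "\<dots> \<le> \<eta>' + 2 * B * \<eta>' + 2 * B * (?n * e k / \<delta>)\<^sup>2 * C"
        using elim B by (intro add_mono mult_left_mono) auto
      also have "\<dots> < \<eta>" using elim(2) \<eta>'(2) by linarith
      finally show ?case .
    qed
  qed
  from tendsto_add[OF this main] show ?thesis by simp
qed

subsection \<open>Heavy-traffic limit\<close>

text \<open>The bias-variance decomposition, applied to the services and then to the arrivals. The
  squared difference of the mean rates is \<epsilon>^2 in the application and disappears in the
  limit.\<close>

lemma (in load_balancer) net_second_moment_eq:
  "net_second_moment = (\<integral>x. (real x - mean_arrivals)\<^sup>2 \<partial>A)
    + (\<integral>y. (queue_total y - (\<Sum>i\<in>UNIV. \<mu> i))\<^sup>2 \<partial>S) + (mean_arrivals - (\<Sum>i\<in>UNIV. \<mu> i))\<^sup>2"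
proof -
  let ?\<alpha> = mean_arrivals and ?\<beta> = "\<Sum>i\<in>UNIV. \<mu> i"
  have A: "integrable A (\<lambda>x. real x)" "integrable A (\<lambda>x. (real x)\<^sup>2)"
    by (rule integrable_pmf_bounded[where B = b], simp add: A_le)
      (rule integrable_pmf_bounded[where B = "(real b)\<^sup>2"], simp add: A_le power_mono)
  have Si: "integrable S (\<lambda>y. real (y $ i))" for i
    by (rule integrable_pmf_bounded[where B = b]) (simp add: S_le)
  have S2: "integrable S (\<lambda>y. (queue_total y)\<^sup>2)"
  proof (rule integrable_pmf_bounded)
    show "norm ((queue_total y)\<^sup>2) \<le> (real CARD('n) * b)\<^sup>2" if "y \<in> set_pmf S" for y
      using power_mono[OF queue_total_service_le[OF that], of 2] by (simp add: sum_nonneg)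
  qed
  have S1: "integrable S queue_total" and ES: "(\<integral>y. queue_total y \<partial>S) = ?\<beta>"
    using Si by (auto intro!: Bochner_Integration.integrable_sum simp: Bochner_Integration.integral_sum)
  have inner: "(\<integral>y. (real x - queue_total y)\<^sup>2 \<partial>S) = (real x - ?\<beta>)\<^sup>2 + (\<integral>y. (queue_total y - ?\<beta>)\<^sup>2 \<partial>S)" for x
    using S1 S2 by (simp add: power2_diff ES) (simp add: power2_eq_square algebra_simps)
  have "net_second_moment = (\<integral>x. (\<integral>y. (real x - queue_total y)\<^sup>2 \<partial>S) \<partial>A)"
    unfolding net_second_moment_def
  proof (subst integral_pair_pmf_bounded[where B = "(real CARD('n) * b)\<^sup>2"])
    show "\<bar>(net_total (x, y))\<^sup>2\<bar> \<le> (real CARD('n) * b)\<^sup>2" if "x \<in> set_pmf A" "y \<in> set_pmf S" for x y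
      using power_mono[OF abs_net_total_le[OF that], of 2] by simp
  qed simp
  also have "\<dots> = (\<integral>x. (real x - ?\<beta>)\<^sup>2 \<partial>A) + (\<integral>y. (queue_total y - ?\<beta>)\<^sup>2 \<partial>S)"
    unfolding inner using A by (simp add: power2_diff)
  also have "(\<integral>x. (real x - ?\<beta>)\<^sup>2 \<partial>A) = (\<integral>x. (real x - ?\<alpha>)\<^sup>2 \<partial>A) + (?\<alpha> - ?\<beta>)\<^sup>2"
    using A by (simp add: power2_diff) (simp add: power2_eq_square algebra_simps)
  finally show ?thesis by simp
qed

lemma inner_one_covariance_matrix:
  fixes X :: "'w \<Rightarrow> real ^ 'n::finite"
  assumes int: "\<And>i j. integrable M (\<lambda>\<omega>. (X \<omega> $ i - mean_vec M X $ i) * (X \<omega> $ j - mean_vec M X $ j))"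
  shows "(1 :: real ^ 'n) \<bullet> (covariance_matrix M X *v 1)
    = (\<integral>\<omega>. ((\<Sum>i\<in>UNIV. X \<omega> $ i) - (\<Sum>i\<in>UNIV. mean_vec M X $ i))\<^sup>2 \<partial>M)"
proof -
  have "((\<Sum>i\<in>UNIV. X \<omega> $ i) - (\<Sum>i\<in>UNIV. mean_vec M X $ i))\<^sup>2 =
      (\<Sum>i\<in>UNIV. \<Sum>j\<in>UNIV. (X \<omega> $ i - mean_vec M X $ i) * (X \<omega> $ j - mean_vec M X $ j))" for \<omega>
    by (simp add: power2_eq_square sum_product flip: sum_subtractf)
  then show ?thesis
    using int by (simp add: inner_vec_def matrix_vector_mult_def covariance_matrix_def
        Bochner_Integration.integral_sum Bochner_Integration.integrable_sum)
qed

theorem theorem5: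
  fixes M :: "'w measure"
    and d :: nat
    and a :: "real \<Rightarrow> nat \<Rightarrow> 'w \<Rightarrow> nat"
    and s :: "nat \<Rightarrow> 'w \<Rightarrow> nat ^ 'n::finite"
    and sel :: "real \<Rightarrow> nat \<Rightarrow> 'w \<Rightarrow> 'n set"
    and dest :: "real \<Rightarrow> nat \<Rightarrow> 'w \<Rightarrow> 'n"
    and q :: "real \<Rightarrow> nat \<Rightarrow> 'w \<Rightarrow> nat ^ 'n"
    and N :: "real \<Rightarrow> 'v measure"
    and qbar :: "real \<Rightarrow> 'v \<Rightarrow> nat ^ 'n"
    and P :: "'p measure"
    and \<Upsilon> :: "'p \<Rightarrow> real"
    and \<mu> :: "real ^ 'n" and \<Sigma>\<^sub>s :: "real ^ 'n ^ 'n"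
    and \<mu>\<^sub>\<Sigma> \<sigma>\<^sub>a :: real
    and A_max S_max :: nat
  assumes d: "2 \<le> d" "d \<le> CARD('n)"
    and \<mu>: "\<mu> = mean_vec M (\<lambda>\<omega>. real_vec (s 1 \<omega>))"
    and \<Sigma>\<^sub>s: "\<Sigma>\<^sub>s = covariance_matrix M (\<lambda>\<omega>. real_vec (s 1 \<omega>))"
    and \<mu>\<^sub>\<Sigma>: "\<mu>\<^sub>\<Sigma> = (\<Sum>i\<in>UNIV. \<mu> $ i)"
    and system: "\<And>\<epsilon>. \<epsilon> \<in> {0<..<\<mu>\<^sub>\<Sigma>} \<Longrightarrow>
          power_of_d_choices M d (a \<epsilon>) s (sel \<epsilon>) (dest \<epsilon>) (q \<epsilon>)"
    and arrival_rate: "\<And>\<epsilon>. \<epsilon> \<in> {0<..<\<mu>\<^sub>\<Sigma>} \<Longrightarrow>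
          prob_space.expectation M (\<lambda>\<omega>. real (a \<epsilon> 1 \<omega>)) = \<mu>\<^sub>\<Sigma> - \<epsilon>"
    and arrivals_bounded: "\<And>\<epsilon> k. \<epsilon> \<in> {0<..<\<mu>\<^sub>\<Sigma>} \<Longrightarrow> AE \<omega> in M. a \<epsilon> k \<omega> \<le> A_max"
    and services_bounded: "\<And>k i. AE \<omega> in M. s k \<omega> $ i \<le> S_max"
    and interior: "\<mu> \<in> interior (capacity_set d)"
    and steady_state_space: "\<And>\<epsilon>. \<epsilon> \<in> {0<..<\<mu>\<^sub>\<Sigma>} \<Longrightarrow> prob_space (N \<epsilon>)"
    and steady_state_measurable: "\<And>\<epsilon>. \<epsilon> \<in> {0<..<\<mu>\<^sub>\<Sigma>} \<Longrightarrow>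
          qbar \<epsilon> \<in> measurable (N \<epsilon>) (count_space UNIV)"
    and steady_state_limit: "\<And>\<epsilon>. \<epsilon> \<in> {0<..<\<mu>\<^sub>\<Sigma>} \<Longrightarrow>
          converges_in_distribution sequentially
            (\<lambda>_. M) (\<lambda>k \<omega>. real_vec (q \<epsilon> k \<omega>)) (N \<epsilon>) (\<lambda>\<omega>. real_vec (qbar \<epsilon> \<omega>))"
    and \<sigma>\<^sub>a: "((\<lambda>\<epsilon>. sqrt (prob_space.variance M (\<lambda>\<omega>. real (a \<epsilon> 1 \<omega>)))) \<longlongrightarrow> \<sigma>\<^sub>a) (at_right 0)"
    and \<Upsilon>: "prob_space P" "\<Upsilon> \<in> borel_measurable P"
          "exponential_with_mean P \<Upsilon>
             (1 / (2 * real CARD('n)) * (\<sigma>\<^sub>a\<^sup>2 + (1 :: real ^ 'n) \<bullet> (\<Sigma>\<^sub>s *v 1)))"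
  shows "converges_in_distribution (at_right 0)
           N (\<lambda>\<epsilon> \<omega>. \<epsilon> *\<^sub>R real_vec (qbar \<epsilon> \<omega>)) P (\<lambda>\<omega>. \<Upsilon> \<omega> *\<^sub>R (1 :: real ^ 'n))"
proof -
  let ?n = "real CARD('n)"
  have \<mu>\<^sub>\<Sigma>_pos: "0 < \<mu>\<^sub>\<Sigma>"
    unfolding \<mu>\<^sub>\<Sigma> using interior_capacity_set_pos[OF interior d] .
  \<comment> \<open>Any admissible parameter serves: \<open>M\<close> and the services do not depend
    on it, so one system shows that \<open>M\<close> is a probability space and that
    \<open>s 1\<close> is measurable.\<close>
  then have "\<mu>\<^sub>\<Sigma> / 2 \<in> {0<..<\<mu>\<^sub>\<Sigma>}" by simp
  from system[OF this] interpret M: prob_space M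
    by (simp add: power_of_d_choices_def)
  have s_meas: "s 1 \<in> measurable M (count_space UNIV)"
    using power_of_d_choices.measurable_s[OF system[OF \<open>\<mu>\<^sub>\<Sigma> / 2 \<in> {0<..<\<mu>\<^sub>\<Sigma>}\<close>]] .
  have a_meas: "a \<epsilon> 1 \<in> measurable M (count_space UNIV)" if "\<epsilon> \<in> {0<..<\<mu>\<^sub>\<Sigma>}" for \<epsilon>
    using power_of_d_choices.measurable_a[OF system[OF that]] .
  define S where "S = law M (s 1)"
  define A where "A \<epsilon> = law M (a \<epsilon> 1)" for \<epsilon>
  define \<pi> where "\<pi> \<epsilon> = law (N \<epsilon>) (qbar \<epsilon>)" for \<epsilon>
  define b where "b = max A_max S_max"
  have \<mu>_S: "(\<integral>y. real (y $ i) \<partial>S) = \<mu> $ i" for i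
    unfolding S_def M.integral_law[OF s_meas] by (simp add: \<mu> mean_vec_def real_vec_def)
  have \<mu>\<^sub>\<Sigma>_S: "(\<Sum>i\<in>UNIV. \<integral>y. real (y $ i) \<partial>S) = \<mu>\<^sub>\<Sigma>"
    by (simp add: \<mu>_S \<mu>\<^sub>\<Sigma>)
  have S_le: "y $ i \<le> S_max" if "y \<in> set_pmf S" for y i
    using M.AE_law[OF s_meas services_bounded that[unfolded S_def]] .
  have mean_A: "(\<integral>x. real x \<partial>A \<epsilon>) = \<mu>\<^sub>\<Sigma> - \<epsilon>" if "\<epsilon> \<in> {0<..<\<mu>\<^sub>\<Sigma>}" for \<epsilon>
    unfolding A_def M.integral_law[OF a_meas[OF that]] by (rule arrival_rate[OF that])
  have lb: "load_balancer (A \<epsilon>) S d b" if \<epsilon>: "\<epsilon> \<in> {0<..<\<mu>\<^sub>\<Sigma>}" for \<epsilon>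
  proof
    show "x \<le> b" if "x \<in> set_pmf (A \<epsilon>)" for x
      using M.AE_law[OF a_meas[OF \<epsilon>] arrivals_bounded[OF \<epsilon>] that[unfolded A_def]] by (simp add: b_def)
    show "y $ i \<le> b" if "y \<in> set_pmf S" for y i
      using S_le[OF that, of i] by (simp add: b_def)
  qed (use d in auto)
  have stat: "\<pi> \<epsilon> = bind_pmf (\<pi> \<epsilon>) (kernel (A \<epsilon>) S d)" if \<epsilon>: "\<epsilon> \<in> {0<..<\<mu>\<^sub>\<Sigma>}" for \<epsilon>
    unfolding \<pi>_def A_def S_def
    by (rule power_of_d_choices.limit_law_stationary[OF system[OF \<epsilon>] steady_state_space[OF \<epsilon>]
          steady_state_measurable[OF \<epsilon>] steady_state_limit[OF \<epsilon>]])
  have d_pos: "0 < d" using d by simp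
  obtain \<delta> where \<delta>: "0 < \<delta>"
    "\<And>H. H \<noteq> {} \<Longrightarrow> H \<noteq> UNIV \<Longrightarrow>
      (\<Sum>i\<in>UNIV. \<mu> $ i) * (real (card H choose d) / real (CARD('n) choose d)) + \<delta> \<le> (\<Sum>i\<in>H. \<mu> $ i)"
    by (rule interior_capacity_set_margin[OF interior d_pos d(2)]) blast
  obtain C where C:
    "\<And>A \<epsilon> \<pi>. load_balancer A S d b \<Longrightarrow> 0 < \<epsilon> \<Longrightarrow> \<epsilon> \<le> \<delta> / 2 \<Longrightarrow>
      (\<integral>x. real x \<partial>A) = (\<Sum>i\<in>UNIV. \<integral>y. real (y $ i) \<partial>S) - \<epsilon> \<Longrightarrow> \<pi> = bind_pmf \<pi> (kernel A S d) \<Longrightarrow>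
      integrable \<pi> (\<lambda>v. (queue_spread v)\<^sup>2) \<and> (\<integral>v. (queue_spread v)\<^sup>2 \<partial>\<pi>) \<le> C"
    by (rule state_space_collapse[of \<delta> S d b]) (use \<delta> \<mu>_S in auto)
  \<comment> \<open>Below the total service rate the systems exist; below \<delta> / 2 the uniform
    collapse bound holds.\<close>
  define \<epsilon>\<^sub>0 where "\<epsilon>\<^sub>0 = min \<mu>\<^sub>\<Sigma> (\<delta> / 2)"
  have \<epsilon>\<^sub>0: "0 < \<epsilon>\<^sub>0" using \<mu>\<^sub>\<Sigma>_pos \<delta>(1) by (simp add: \<epsilon>\<^sub>0_def)
  have near: "\<forall>\<^sub>F \<epsilon> in at_right 0. \<epsilon> \<in> {0<..<\<epsilon>\<^sub>0}"
    by (rule eventually_at_right_real[OF \<epsilon>\<^sub>0])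
  have in_range: "\<epsilon> \<in> {0<..<\<mu>\<^sub>\<Sigma>}" if "\<epsilon> \<in> {0<..<\<epsilon>\<^sub>0}" for \<epsilon>
    using that by (simp add: \<epsilon>\<^sub>0_def)
  have slb: "stationary_load_balancer (A \<epsilon>) S d b (\<pi> \<epsilon>) \<epsilon> C" if \<epsilon>: "\<epsilon> \<in> {0<..<\<epsilon>\<^sub>0}" for \<epsilon>
  proof -
    note r = in_range[OF \<epsilon>]
    have rate: "(\<integral>x. real x \<partial>A \<epsilon>) = (\<Sum>i\<in>UNIV. \<integral>y. real (y $ i) \<partial>S) - \<epsilon>"
      by (simp add: mean_A[OF r] \<mu>\<^sub>\<Sigma>_S)
    have "0 < \<epsilon>" "\<epsilon> \<le> \<delta> / 2" using \<epsilon> by (auto simp: \<epsilon>\<^sub>0_def)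
    with C[OF lb[OF r] _ _ rate stat[OF r]] lb[OF r] rate stat[OF r] show ?thesis
      by (auto simp: stationary_load_balancer_def stationary_load_balancer_axioms_def)
  qed
  define v where "v = (1 :: real ^ 'n) \<bullet> (\<Sigma>\<^sub>s *v 1)"
  have v_eq: "v = (\<integral>y. (queue_total y - \<mu>\<^sub>\<Sigma>)\<^sup>2 \<partial>S)"
  proof -
    have "integrable M (\<lambda>\<omega>. (real_vec (s 1 \<omega>) $ i - \<mu> $ i) * (real_vec (s 1 \<omega>) $ j - \<mu> $ j))" for i j
    proof (rule M.integrable_const_bound)
      show "AE \<omega> in M. norm ((real_vec (s 1 \<omega>) $ i - \<mu> $ i) * (real_vec (s 1 \<omega>) $ j - \<mu> $ j))
          \<le> (real S_max + \<bar>\<mu> $ i\<bar>) * (real S_max + \<bar>\<mu> $ j\<bar>)"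
        using services_bounded[of 1 i] services_bounded[of 1 j]
        by eventually_elim (auto simp: real_vec_def abs_mult intro!: mult_mono)
      show "(\<lambda>\<omega>. (real_vec (s 1 \<omega>) $ i - \<mu> $ i) * (real_vec (s 1 \<omega>) $ j - \<mu> $ j)) \<in> borel_measurable M"
        by (rule measurable_compose[OF s_meas]) simp
    qed
    then have "v = (\<integral>\<omega>. ((\<Sum>i\<in>UNIV. real_vec (s 1 \<omega>) $ i) - (\<Sum>i\<in>UNIV. \<mu> $ i))\<^sup>2 \<partial>M)"
      unfolding v_def \<Sigma>\<^sub>s \<mu> by (intro inner_one_covariance_matrix)
    then show ?thesis
      unfolding S_def M.integral_law[OF s_meas] by (simp add: real_vec_def \<mu>\<^sub>\<Sigma>)
  qed
  have moment_eq: "load_balancer.net_second_moment (A \<epsilon>) S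
      = (sqrt (M.variance (\<lambda>\<omega>. real (a \<epsilon> 1 \<omega>))))\<^sup>2 + v + \<epsilon>\<^sup>2" if "\<epsilon> \<in> {0<..<\<epsilon>\<^sub>0}" for \<epsilon>
  proof -
    note r = in_range[OF that]
    interpret load_balancer "A \<epsilon>" S d b by (rule lb[OF r])
    have "(\<integral>x. (real x - (\<mu>\<^sub>\<Sigma> - \<epsilon>))\<^sup>2 \<partial>A \<epsilon>) = M.variance (\<lambda>\<omega>. real (a \<epsilon> 1 \<omega>))"
      unfolding A_def M.integral_law[OF a_meas[OF r]] arrival_rate[OF r] ..
    then show ?thesis
      using net_second_moment_eq unfolding mean_A[OF r] \<mu>\<^sub>\<Sigma>_S v_eq
      by (simp add: M.variance_positive)
  qed
  \<comment> \<open>The prescribed mean of \<Upsilon> is \<open>m / (2 * n)\<close>.\<close>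
  define m where "m = \<sigma>\<^sub>a\<^sup>2 + v"
  have moment: "((\<lambda>\<epsilon>. load_balancer.net_second_moment (A \<epsilon>) S) \<longlongrightarrow> m) (at_right 0)"
  proof (rule Lim_transform_eventually)
    have "((\<lambda>\<epsilon>. (sqrt (M.variance (\<lambda>\<omega>. real (a \<epsilon> 1 \<omega>))))\<^sup>2 + v + \<epsilon>\<^sup>2) \<longlongrightarrow> \<sigma>\<^sub>a\<^sup>2 + v + 0\<^sup>2) (at_right 0)"
      by (intro tendsto_intros \<sigma>\<^sub>a)
    then show "((\<lambda>\<epsilon>. (sqrt (M.variance (\<lambda>\<omega>. real (a \<epsilon> 1 \<omega>))))\<^sup>2 + v + \<epsilon>\<^sup>2) \<longlongrightarrow> m) (at_right 0)"
      by (simp add: m_def)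
    show "\<forall>\<^sub>F \<epsilon> in at_right 0. (sqrt (M.variance (\<lambda>\<omega>. real (a \<epsilon> 1 \<omega>))))\<^sup>2 + v + \<epsilon>\<^sup>2
        = load_balancer.net_second_moment (A \<epsilon>) S"
      using near by eventually_elim (simp only: moment_eq)
  qed
  have m_nonneg: "0 \<le> m" by (simp add: m_def v_eq)
  have char: "((\<lambda>\<epsilon>. \<integral>w. iexp (t * (\<epsilon> / ?n * queue_total w)) \<partial>\<pi> \<epsilon>)
      \<longlongrightarrow> char (distr P borel \<Upsilon>) t) (at_right 0)" for t
  proof -
    have "char (distr P borel \<Upsilon>) t = 1 / (1 - \<i> * t * (m / (2 * ?n)))"
      using \<Upsilon> m_nonneg by (intro char_exponential_with_mean) (auto simp: m_def v_def)
    moreover have "\<forall>\<^sub>F \<epsilon> in at_right 0. stationary_load_balancer (A \<epsilon>) S d b (\<pi> \<epsilon>) \<epsilon> C"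
      using near by eventually_elim (rule slb)
    ultimately show ?thesis
      using heavy_traffic_char[OF _ moment, of d b \<pi> C t] by simp
  qed
  have real_distr: "real_distribution (distr P borel \<Upsilon>)"
    using \<Upsilon> by (intro prob_space.real_distribution_distr)
  have limit: "((\<lambda>\<epsilon>. \<integral>w. f (\<epsilon> *\<^sub>R real_vec w) \<partial>\<pi> \<epsilon>) \<longlongrightarrow> (\<integral>x. f (x *\<^sub>R 1) \<partial>distr P borel \<Upsilon>)) (at_right 0)"
    if f: "continuous_on UNIV f" "bounded (range f)" for f :: "real ^ 'n \<Rightarrow> real"
    \<comment> \<open>Levy's continuity theorem concerns sequences, so the one-sided limit is tested
      along each sequence of parameters that decreases to 0 in the sense of
      \<open>at_right 0\<close>.\<close>
    unfolding tendsto_at_iff_sequentially comp_def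
  proof (intro allI impI)
    fix e :: "nat \<Rightarrow> real"
    assume e: "\<forall>k. e k \<in> {0<..} - {0}" "e \<longlonglongrightarrow> 0"
    then have lim: "filterlim e (at_right 0) sequentially"
      by (intro tendsto_imp_filterlim_at_right) auto
    show "(\<lambda>k. \<integral>w. f (e k *\<^sub>R real_vec w) \<partial>\<pi> (e k)) \<longlonglongrightarrow> (\<integral>x. f (x *\<^sub>R 1) \<partial>distr P borel \<Upsilon>)"
    proof (rule weak_convergence_to_diagonal[OF _ e(2) _ real_distr _ f])
      show "0 < e k" for k using e(1) by auto
      show "\<forall>\<^sub>F k in sequentially. integrable (\<pi> (e k)) (\<lambda>w. (queue_spread w)\<^sup>2)
          \<and> (\<integral>w. (queue_spread w)\<^sup>2 \<partial>\<pi> (e k)) \<le> C"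
        using filterlim_iff[THEN iffD1, OF lim, rule_format, OF near]
        by eventually_elim (use stationary_load_balancer.collapse[OF slb] in blast)
      show "weak_conv_m (\<lambda>k. distr (\<pi> (e k)) borel (\<lambda>w. e k / ?n * queue_total w)) (distr P borel \<Upsilon>)"
      proof (rule levy_continuity[OF _ real_distr])
        show "real_distribution (distr (\<pi> (e k)) borel (\<lambda>w. e k / ?n * queue_total w))" for k
          by (intro prob_space.real_distribution_distr[OF prob_space_measure_pmf]) simp
        show "(\<lambda>k. char (distr (\<pi> (e k)) borel (\<lambda>w. e k / ?n * queue_total w)) t)
            \<longlonglongrightarrow> char (distr P borel \<Upsilon>) t" for t
          using filterlim_compose[OF char lim, of t] by (simp only: char_def) (subst integral_distr; simp)
      qed
    qed
  qed
  have \<Upsilon>_meas: "\<Upsilon> \<in> borel_measurable P" by (rule \<Upsilon>(2))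
  show ?thesis
    unfolding converges_in_distribution_def
  proof (intro conjI allI impI)
    show "\<forall>\<^sub>F \<epsilon> in at_right 0. (\<lambda>\<omega>. \<epsilon> *\<^sub>R real_vec (qbar \<epsilon> \<omega>)) \<in> borel_measurable (N \<epsilon>)"
      using near
    proof eventually_elim
      case (elim \<epsilon>)
      show ?case
        by (rule measurable_compose[OF steady_state_measurable[OF in_range[OF elim]]]) simp
    qed
    show "(\<lambda>\<omega>. \<Upsilon> \<omega> *\<^sub>R (1 :: real ^ 'n)) \<in> borel_measurable P"
      using \<Upsilon>_meas by simp
    fix f :: "real ^ 'n \<Rightarrow> real" assume f: "continuous_on UNIV f" "bounded (range f)"
    have [measurable]: "f \<in> borel_measurable borel" using f(1) by (rule borel_measurable_continuous_onI)
    have "(\<integral>x. f (x *\<^sub>R 1) \<partial>distr P borel \<Upsilon>) = (\<integral>\<omega>. f (\<Upsilon> \<omega> *\<^sub>R 1) \<partial>P)"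
      by (rule integral_distr[OF \<Upsilon>_meas]) measurable
    moreover have "\<forall>\<^sub>F \<epsilon> in at_right 0. (\<integral>w. f (\<epsilon> *\<^sub>R real_vec w) \<partial>\<pi> \<epsilon>) = (\<integral>\<omega>. f (\<epsilon> *\<^sub>R real_vec (qbar \<epsilon> \<omega>)) \<partial>N \<epsilon>)"
      using near
    proof eventually_elim
      case (elim \<epsilon>)
      note r = in_range[OF elim]
      show ?case
        unfolding \<pi>_def by (rule prob_space.integral_law[OF steady_state_space[OF r] steady_state_measurable[OF r]])
    qed
    ultimately show "((\<lambda>\<epsilon>. \<integral>\<omega>. f (\<epsilon> *\<^sub>R real_vec (qbar \<epsilon> \<omega>)) \<partial>N \<epsilon>)
        \<longlongrightarrow> (\<integral>\<omega>. f (\<Upsilon> \<omega> *\<^sub>R 1) \<partial>P)) (at_right 0)"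
      using Lim_transform_eventually[OF limit[OF f]] by simp
  qed
qed

end
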